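(* Let $(\Gamma,\gamma)$ be a spin network such that $\Gamma$ has no trivial components and no loops. Then $|\langle\Gamma,\gamma\rangle^U|\le 1$.
   Context: A cubic ribbon graph $\Gamma=(G,R)$ consists of a finite graph $G$ in which every vertex has degree $3$ (multiple edges and loops are allowed, a loop being an edge whose two ends are at the same vertex and counting $2$ towards the degree; $G$ may be disconnected; $G$ may also contain "trivial components", each consisting of a single edge closing on itself with no vertex), together with a cyclic ordering $R$ of the three half-edges at each vertex. This determines (up to orientation-preserving equivalence) an embedding of $G$ into a closed orientable surface $\Sigma$. A decoration $\gamma:E(G)\to\{0,1,2,\dots\}$ is admissible if at every vertex, with $a,b,c$ the decorations of the incident half-edges (a loop's decoration counted twice), $a+b+c$ is even and $|a-b|\le c\le a+b$; a spin network is a pair $(\Gamma,\gamma)$ with $\gamma$ admissible. The Penrose evaluation $\langle\Gamma,\gamma\rangle^P$ is defined as follows: thicken the embedded graph on $\Sigma$ into a ribbon surface; replace each edge $e$ by $\gamma(e)$ parallel strands; at each vertex with incident decorations $a,b,c$, connect strands without crossings so that $\frac{a+b-c}{2}$ strands join the $a$-edge to the $b$-edge, $\frac{a+c-b}{2}$ join the $a$-edge to the $c$-edge and $\frac{b+c-a}{2}$ join the $b$-edge to the $c$-edge; on each edge $e$ insert a permutation $\sigma_e\in\mathfrak S_{\gamma(e)}$ of its strands. Each state $\vec\sigma=(\sigma_e)_e$ yields a collection of $N(\vec\sigma)$ closed curves on $\Sigma$, and $\langle\Gamma,\gamma\rangle^P=\sum_{\vec\sigma}\big(\prod_e \mathrm{sign}(\sigma_e)\big)(-2)^{N(\vec\sigma)}$.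 The standard evaluation is $\langle\Gamma,\gamma\rangle^S=\langle\Gamma,\gamma\rangle^P\prod_{v\in V(\Gamma)}\big[(\tfrac{a_v+b_v-c_v}{2})!(\tfrac{a_v+c_v-b_v}{2})!(\tfrac{b_v+c_v-a_v}{2})!\big]^{-1}$, where $a_v,b_v,c_v$ are the decorations at $v$ (loop counted twice), and the unitary evaluation is $\langle\Gamma,\gamma\rangle^U=\langle\Gamma,\gamma\rangle^S\prod_{v}\Theta(a_v,b_v,c_v)^{-1/2}$ with $\Theta(a,b,c)=\frac{(\frac{a+b+c}{2}+1)!}{(\frac{a+b-c}{2})!(\frac{a+c-b}{2})!(\frac{b+c-a}{2})!}$. *)

theory Defs
  imports Complex_Main "HOL-Combinatorics.Permutations"
begin

text \<open>Combinatorial model of a cubic ribbon graph without trivial components.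
  Edges form a finite type 'e; each edge e has two ends (half-edges) (e,True), (e,False).
  The ribbon structure is a permutation rho of the half-edges all of whose cycles have
  length 3: each cycle is a vertex, and rho gives the cyclic (counterclockwise) order of the
  three half-edges at that vertex. Loops and multiple edges are allowed by this model.\<close>

type_synonym 'e hedge = "'e \<times> bool"

definition cubic_ribbon :: "('e hedge \<Rightarrow> 'e hedge) \<Rightarrow> bool" where
  "cubic_ribbon \<rho> \<longleftrightarrow> bij \<rho> \<and> (\<forall>h. \<rho> (\<rho> (\<rho> h)) = h \<and> \<rho> h \<noteq> h)"

definition rvertices :: "('e hedge \<Rightarrow> 'e hedge) \<Rightarrow> 'e hedge set set" where
  "rvertices \<rho> = range (\<lambda>h. {h, \<rho> h, \<rho> (\<rho> h)})"

text \<open>No loops: the two ends of each edge lie at different vertices.\<close>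
definition no_loops :: "('e hedge \<Rightarrow> 'e hedge) \<Rightarrow> bool" where
  "no_loops \<rho> \<longleftrightarrow> (\<forall>e. (e, False) \<notin> {(e, True), \<rho> (e, True), \<rho> (\<rho> (e, True))})"

text \<open>Admissibility at every vertex (checked at every half-edge h, with
  a, b, c the decorations of h, rho h, rho (rho h)).\<close>
definition admissible :: "('e hedge \<Rightarrow> 'e hedge) \<Rightarrow> ('e \<Rightarrow> nat) \<Rightarrow> bool" where
  "admissible \<rho> \<gamma> \<longleftrightarrow> (\<forall>h. let a = \<gamma> (fst h); b = \<gamma> (fst (\<rho> h)); c = \<gamma> (fst (\<rho> (\<rho> h))) in
      even (a + b + c) \<and> \<bar>int a - int b\<bar> \<le> int c \<and> c \<le> a + b)"

text \<open>Number of strands joining half-edge h to the next half-edge rho h at their vertex.\<close>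
definition xnext :: "('e hedge \<Rightarrow> 'e hedge) \<Rightarrow> ('e \<Rightarrow> nat) \<Rightarrow> 'e hedge \<Rightarrow> nat" where
  "xnext \<rho> \<gamma> h = (\<gamma> (fst h) + \<gamma> (fst (\<rho> h)) - \<gamma> (fst (\<rho> (\<rho> h)))) div 2"

text \<open>Strand end-points: position i (counted counterclockwise around the vertex) on half-edge h.\<close>
definition spoints :: "('e \<Rightarrow> nat) \<Rightarrow> ('e hedge \<times> nat) set" where
  "spoints \<gamma> = {(h, i). i < \<gamma> (fst h)}"

text \<open>Strands along an edge e, with the permutation sigma e inserted.  Counterclockwise
  positions at the two ends of an (untwisted) ribbon edge are in reversed order.\<close>
definition edge_links :: "('e \<Rightarrow> nat) \<Rightarrow> ('e \<Rightarrow> nat \<Rightarrow> nat) \<Rightarrow> (('e hedge \<times> nat) \<times> ('e hedge \<times> nat)) set" where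
  "edge_links \<gamma> \<sigma> = {(((e, True), i), ((e, False), \<gamma> e - 1 - \<sigma> e i)) | e i. i < \<gamma> e}"

text \<open>Crossingless connections at the vertices: the last xnext h strands of h are joined,
  nestedly, to the first xnext h strands of rho h.\<close>
definition vertex_links :: "('e hedge \<Rightarrow> 'e hedge) \<Rightarrow> ('e \<Rightarrow> nat) \<Rightarrow> (('e hedge \<times> nat) \<times> ('e hedge \<times> nat)) set" where
  "vertex_links \<rho> \<gamma> = {((h, i), (\<rho> h, \<gamma> (fst h) - 1 - i)) | h i.
       i < \<gamma> (fst h) \<and> \<gamma> (fst h) - xnext \<rho> \<gamma> h \<le> i}"

text \<open>Number of closed curves of the state sigma: connected components of the strand diagram.\<close>
definition ncurves :: "('e hedge \<Rightarrow> 'e hedge) \<Rightarrow> ('e \<Rightarrow> nat) \<Rightarrow> ('e \<Rightarrow> nat \<Rightarrow> nat) \<Rightarrow> nat" where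
  "ncurves \<rho> \<gamma> \<sigma> = (let R = edge_links \<gamma> \<sigma> \<union> vertex_links \<rho> \<gamma> in
      card (spoints \<gamma> // ((R \<union> R\<inverse>)\<^sup>*)))"

definition states :: "('e \<Rightarrow> nat) \<Rightarrow> ('e \<Rightarrow> nat \<Rightarrow> nat) set" where
  "states \<gamma> = {\<sigma>. \<forall>e. \<sigma> e permutes {..<\<gamma> e}}"

definition penrose_eval :: "('e::finite hedge \<Rightarrow> 'e hedge) \<Rightarrow> ('e \<Rightarrow> nat) \<Rightarrow> real" where
  "penrose_eval \<rho> \<gamma> = (\<Sum>\<sigma>\<in>states \<gamma>. (\<Prod>e\<in>UNIV. real_of_int (sign (\<sigma> e))) * (-2) ^ ncurves \<rho> \<gamma> \<sigma>)"

text \<open>For a vertex v = {h, rho h, rho(rho h)}, the three numbers xnext are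
  (a+b-c)/2, (b+c-a)/2, (c+a-b)/2.\<close>
definition standard_eval :: "('e::finite hedge \<Rightarrow> 'e hedge) \<Rightarrow> ('e \<Rightarrow> nat) \<Rightarrow> real" where
  "standard_eval \<rho> \<gamma> = penrose_eval \<rho> \<gamma> /
      (\<Prod>v\<in>rvertices \<rho>. \<Prod>h\<in>v. fact (xnext \<rho> \<gamma> h))"

definition Theta :: "nat \<Rightarrow> nat \<Rightarrow> nat \<Rightarrow> real" where
  "Theta a b c = fact ((a + b + c) div 2 + 1) /
     (fact ((a + b - c) div 2) * fact ((a + c - b) div 2) * fact ((b + c - a) div 2))"

definition unitary_eval :: "('e::finite hedge \<Rightarrow> 'e hedge) \<Rightarrow> ('e \<Rightarrow> nat) \<Rightarrow> real" where
  "unitary_eval \<rho> \<gamma> = standard_eval \<rho> \<gamma> *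
      (\<Prod>v\<in>rvertices \<rho>. 1 / sqrt (THE t. \<exists>h\<in>v. v = {h, \<rho> h, \<rho> (\<rho> h)} \<and>
          t = Theta (\<gamma> (fst h)) (\<gamma> (fst (\<rho> h))) (\<gamma> (fst (\<rho> (\<rho> h))))))"

end

theory Submission
  imports Defs "HOL-Analysis.L2_Norm" "HOL-Library.FuncSet" "HOL-Library.Disjoint_Sets"
begin

text \<open>The obstacle is that N depends on the whole diagram, while the bound has to be assembled
  vertex by vertex. Locality comes from one permutation: given an alternating selection X, following
  two links from each selected point permutes X, with one m-cycle for every curve of 2m points. Its
  sign is therefore the same for all 2^N selections, namely (-1)^N up to the parity of half the
  number of points, and summing over X produces (-2)^N.

  This permutation and any fixed one that conjugates edge links into vertex links differ by an
  element of the centralizer of a fixed-point-free involution. Sign on that centralizer is the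
  parity of the number of flipped pairs, so it can be read off from the selected starting points.
  Inserting a state changes the fixed conjugator by a factor of sign exactly that of the state,
  which is why the signs of the state disappear.

  The weight k! (n - k)! counts the permutations that carry a selection pattern at one end of an
  edge to a given pattern at the other. Being symmetric under k -> n - k, it splits into equal
  square roots for the two ends.\<close>

text \<open>
  Select a set \<open>X\<close> of strand end-points that contains exactly one end of every link. A state with
  \<open>N\<close> curves admits \<open>2\<^sup>N\<close> such sets, and comparing permutation signs shows that
  \<open>sign(\<sigma>) (-2)\<^sup>N\<close> is, up to a sign independent of \<open>\<sigma>\<close>, the sum over these \<open>X\<close> of
  \<open>(-1)\<close> to the number of links whose starting point is selected. This weight is multiplicative over
  the links, so summing over \<open>\<sigma>\<close> first and recording only the number \<open>k\<close> of selected points at one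
  end of each edge turns the Penrose evaluation into a contraction of one tensor per vertex, with
  edge weights \<open>\<plusminus> k! (\<gamma>(e) - k)!\<close>. As no edge is a loop, the Cauchy--Schwarz inequality,
  applied edge by edge, bounds the contraction by the product of the \<open>\<ell>\<^sup>2\<close> norms of the vertex tensors.
  The tensor at a vertex consists of the coefficients of \<open>[12]\<^sup>x [23]\<^sup>y [31]\<^sup>z\<close>, whose squared norm with
  weights \<open>k! (n - k)!\<close> is \<open>(x + y + z + 1)! x! y! z!\<close> because multiplication by a bracket is adjoint
  to Cayley's operator. This is exactly the unitary normalization.
\<close>

section \<open>The norm of the vertex tensor\<close>

text \<open>Exponents are integers so that shifts never truncate: the commutation identities below
  hold without side conditions, and boundary terms are simply zero coefficients.\<close>

definition d12 :: "(int \<Rightarrow> int \<Rightarrow> int \<Rightarrow> real) \<Rightarrow> int \<Rightarrow> int \<Rightarrow> int \<Rightarrow> real" where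
  "d12 F a b c = F a (b - 1) c - F (a - 1) b c"
definition d23 :: "(int \<Rightarrow> int \<Rightarrow> int \<Rightarrow> real) \<Rightarrow> int \<Rightarrow> int \<Rightarrow> int \<Rightarrow> real" where
  "d23 F a b c = F a b (c - 1) - F a (b - 1) c"
definition d31 :: "(int \<Rightarrow> int \<Rightarrow> int \<Rightarrow> real) \<Rightarrow> int \<Rightarrow> int \<Rightarrow> int \<Rightarrow> real" where
  "d31 F a b c = F (a - 1) b c - F a b (c - 1)"

definition triv :: "int \<Rightarrow> int \<Rightarrow> int \<Rightarrow> real" where
  "triv a b c = of_bool (a = 0 \<and> b = 0 \<and> c = 0)"

text \<open>\<open>vten x y z a b c\<close> is the coefficient of
  \<open>u\<^sub>1\<^sup>a w\<^sub>1\<^sup>x\<^sup>+\<^sup>z\<^sup>-\<^sup>a u\<^sub>2\<^sup>b w\<^sub>2\<^sup>x\<^sup>+\<^sup>y\<^sup>-\<^sup>b u\<^sub>3\<^sup>c w\<^sub>3\<^sup>y\<^sup>+\<^sup>z\<^sup>-\<^sup>c\<close> in \<open>[12]\<^sup>x [23]\<^sup>y [31]\<^sup>z\<close>, where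
  \<open>[ij] = w\<^sub>i u\<^sub>j - u\<^sub>i w\<^sub>j\<close>; the operators \<open>d12\<close>, \<open>d23\<close>, \<open>d31\<close> multiply by a bracket.\<close>
definition vten :: "nat \<Rightarrow> nat \<Rightarrow> nat \<Rightarrow> int \<Rightarrow> int \<Rightarrow> int \<Rightarrow> real" where
  "vten x y z = (d12 ^^ x) ((d23 ^^ y) ((d31 ^^ z) triv))"

lemma d_commute:
  "d12 (d23 F) = d23 (d12 F)" "d12 (d31 F) = d31 (d12 F)" "d23 (d31 F) = d31 (d23 F)"
  by (auto simp: d12_def d23_def d31_def fun_eq_iff)

lemma d_funpow_commute:
  "d23 ((d12 ^^ n) F) = (d12 ^^ n) (d23 F)" "d31 ((d12 ^^ n) F) = (d12 ^^ n) (d31 F)"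
  "d31 ((d23 ^^ n) F) = (d23 ^^ n) (d31 F)"
  by (induction n) (simp_all add: d_commute [symmetric])

lemma vten_0: "vten 0 0 0 = triv"
  by (simp add: vten_def)

lemma vten_Suc:
  "vten (Suc x) y z = d12 (vten x y z)"
  "vten x (Suc y) z = d23 (vten x y z)"
  "vten x y (Suc z) = d31 (vten x y z)"
  by (simp_all add: vten_def d_funpow_commute)

text \<open>Renaming the legs cyclically turns the brackets [12], [23], [31] into one another
  without any sign. Hence only \<open>x\<close> needs a recursion for the norm.\<close>

lemma vten_rotate: "vten x y z a b c = vten y z x b c a"
proof -
  have "\<forall>a b c. vten x y z a b c = vten y z x b c a"
  proof (induction x)
    case 0
    show ?case
    proof (induction y)
      case 0
      show ?case
        by (induction z) (auto simp: vten_0 vten_Suc triv_def d12_def d23_def d31_def)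
    qed (simp add: vten_Suc d12_def d23_def d31_def)
  qed (simp add: vten_Suc d12_def d23_def d31_def)
  then show ?thesis by blast
qed

lemma vten_support:
  assumes "vten x y z a b c \<noteq> 0"
  shows "0 \<le> a \<and> a \<le> int (x + z) \<and> 0 \<le> b \<and> b \<le> int (x + y) \<and> 0 \<le> c \<and> c \<le> int (y + z)"
proof -
  have "\<forall>a b c. vten x y z a b c \<noteq> 0 \<longrightarrow>
      0 \<le> a \<and> a \<le> int (x + z) \<and> 0 \<le> b \<and> b \<le> int (x + y) \<and> 0 \<le> c \<and> c \<le> int (y + z)"
  proof (induction x)
    case 0
    show ?case
    proof (induction y)
      case 0
      show ?case
      proof (induction z)
        case (Suc z)
        then show ?case by (simp add: vten_Suc d31_def) smt
      qed (simp add: vten_0 triv_def)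
    next
      case (Suc y)
      then show ?case by (simp add: vten_Suc d23_def) smt
    qed
  next
    case (Suc x)
    then show ?case by (simp add: vten_Suc d12_def) smt
  qed
  then show ?thesis using assms by blast
qed

text \<open>On coefficients of polynomials of degree \<open>p\<close> in \<open>(u\<^sub>1, w\<^sub>1)\<close> and \<open>q\<close> in \<open>(u\<^sub>2, w\<^sub>2)\<close>, \<open>cayley\<close> is
  Cayley's operator \<open>\<partial>\<^sub>w\<^sub>1 \<partial>\<^sub>u\<^sub>2 - \<partial>\<^sub>u\<^sub>1 \<partial>\<^sub>w\<^sub>2\<close>, and \<open>polar\<close> is the polarization
  \<open>u\<^sub>3 \<partial>\<^sub>u\<^sub>1 + w\<^sub>3 \<partial>\<^sub>w\<^sub>1\<close>, which arises from commuting \<open>cayley\<close> with \<open>[23]\<close>.\<close>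
definition cayley ::
  "int \<Rightarrow> int \<Rightarrow> (int \<Rightarrow> int \<Rightarrow> int \<Rightarrow> real) \<Rightarrow> int \<Rightarrow> int \<Rightarrow> int \<Rightarrow> real" where
  "cayley p q F a b c =
     of_int ((p - a) * (b + 1)) * F a (b + 1) c - of_int ((a + 1) * (q - b)) * F (a + 1) b c"

definition polar :: "int \<Rightarrow> (int \<Rightarrow> int \<Rightarrow> int \<Rightarrow> real) \<Rightarrow> int \<Rightarrow> int \<Rightarrow> int \<Rightarrow> real" where
  "polar p F a b c = of_int (a + 1) * F (a + 1) b (c - 1) + of_int (p - a) * F a b c"

text \<open>The commutator of Cayley's operator with [12] is the sum of the two Euler operators plus
  2; on degrees \<open>p\<close> and \<open>q\<close> it is the scalar p + q + 2.\<close>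

lemma cayley_d12:
  "cayley (p + 1) (q + 1) (d12 F) a b c = d12 (cayley p q F) a b c + of_int (p + q + 2) * F a b c"
  by (simp add: cayley_def d12_def algebra_simps)

lemma cayley_d23:
  "cayley p (q + 1) (d23 F) a b c = d23 (cayley p q F) a b c - polar p F a b c"
  by (simp add: cayley_def polar_def d23_def algebra_simps)

lemma d_zero: "d12 (\<lambda>a b c. 0) = (\<lambda>a b c. 0)" "d23 (\<lambda>a b c. 0) = (\<lambda>a b c. 0)"
  "d31 (\<lambda>a b c. 0) = (\<lambda>a b c. 0)"
  by (simp_all add: d12_def d23_def d31_def fun_eq_iff)

lemma polar_d23: "polar p (d23 F) = d23 (polar p F)"
  by (simp add: polar_def d23_def fun_eq_iff algebra_simps)

lemma polar_d31: "polar (p + 1) (d31 F) = d31 (polar p F)"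
  by (simp add: polar_def d31_def fun_eq_iff algebra_simps)

text \<open>Polarization is a derivation that replaces a leg-1 variable by the leg-3 one. It sends
  [31] to [33] = 0, and [23] contains no leg-1 variable.\<close>

lemma polar_vten: "polar (int z) (vten 0 y z) = (\<lambda>a b c. 0)"
proof (induction y)
  case 0
  show ?case
  proof (induction z)
    case (Suc z)
    then show ?case
      using polar_d31[of "int z" "vten 0 0 z"] by (simp add: vten_Suc add.commute d_zero)
  qed (auto simp: polar_def vten_0 triv_def fun_eq_iff)
qed (simp add: vten_Suc polar_d23 d_zero)

text \<open>Moving the operator past each [23] costs only a polarization, which vanishes by
  \<open>polar_vten\<close>. Once no [23] is left, leg 2 has degree 0 and there is nothing to
  differentiate.\<close>

lemma cayley_vten_0: "cayley (int z) (int y) (vten 0 y z) = (\<lambda>a b c. 0)"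
proof (induction y)
  case 0
  have "vten 0 0 z a' b' c' = 0" if "b' \<noteq> 0" for a' b' c'
    using vten_support[of 0 0 z a' b' c'] that by force
  then have "cayley (int z) 0 (vten 0 0 z) a b c = 0" for a b c
    by (cases "b = 0"; cases "b = -1") (simp_all add: cayley_def)
  then show ?case by (simp add: fun_eq_iff)
next
  case (Suc y)
  then show ?case
    using cayley_d23[of "int z" "int y" "vten 0 y z"]
    unfolding Suc.IH d_zero polar_vten by (simp add: vten_Suc add.commute fun_eq_iff)
qed

text \<open>The constant collects the commutators with the x + 1 factors [12]: the sum of 2j + y + z
  + 2 over j = 0, ..., x.\<close>

lemma cayley_vten:
  "cayley (int (Suc x + z)) (int (Suc x + y)) (vten (Suc x) y z) a b c
   = of_nat ((x + 1) * (x + y + z + 2)) * vten x y z a b c"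
proof (induction x arbitrary: a b c)
  case 0
  show ?case
    using cayley_d12[of "int z" "int y" "vten 0 y z" a b c]
    by (simp add: vten_Suc add.commute d_zero cayley_vten_0 algebra_simps)
next
  case (Suc x)
  have "cayley (int (Suc (Suc x) + z)) (int (Suc (Suc x) + y)) (vten (Suc (Suc x)) y z) a b c
      = d12 (cayley (int (Suc x + z)) (int (Suc x + y)) (vten (Suc x) y z)) a b c
        + of_nat (2 * x + y + z + 4) * vten (Suc x) y z a b c"
    using cayley_d12[of "int (Suc x + z)" "int (Suc x + y)" "vten (Suc x) y z" a b c]
    unfolding vten_Suc(1)[of "Suc x"] by (simp add: add_ac)
  also have "d12 (cayley (int (Suc x + z)) (int (Suc x + y)) (vten (Suc x) y z)) a b c
      = of_nat ((x + 1) * (x + y + z + 2)) * vten (Suc x) y z a b c"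
    unfolding d12_def [of "cayley _ _ _"] Suc.IH
    by (simp add: vten_Suc(1)[of x] d12_def [of "vten _ _ _"] right_diff_distrib)
  finally show ?case by (simp add: algebra_simps)
qed

definition vnorm :: "nat \<Rightarrow> nat \<Rightarrow> nat \<Rightarrow> real" where
  "vnorm x y z = (\<Sum>a\<le>x + z. \<Sum>b\<le>x + y. \<Sum>c\<le>y + z. (vten x y z (int a) (int b) (int c))\<^sup>2 *
      (fact a * fact (x + z - a)) * (fact b * fact (x + y - b)) * (fact c * fact (y + z - c)))"

lemma vnorm_rotate: "vnorm x y z = vnorm y z x"
proof -
  have "vnorm x y z = (\<Sum>b\<le>x + y. \<Sum>c\<le>y + z. \<Sum>a\<le>x + z. (vten x y z (int a) (int b) (int c))\<^sup>2 *
      (fact a * fact (x + z - a)) * (fact b * fact (x + y - b)) * (fact c * fact (y + z - c)))"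
    unfolding vnorm_def by (subst sum.swap) (rule sum.cong[OF refl], rule sum.swap)
  also have "\<dots> = vnorm y z x"
    unfolding vnorm_def
    by (intro sum.cong) (simp_all add: add.commute vten_rotate[of x y z] mult_ac)
  finally show ?thesis .
qed

text \<open>Multiplication by the bracket \<open>[12]\<close> is adjoint to \<^const>\<open>cayley\<close> for the weights \<open>k! (n - k)!\<close>.\<close>
lemma vnorm_Suc: "vnorm (Suc x) y z = of_nat ((x + 1) * (x + y + z + 2)) * vnorm x y z"
proof -
  define G where "G a b c = vten (Suc x) y z (int a) (int b) (int c)" for a b c :: nat
  define F where "F a b c = vten x y z (int a) (int b) (int c)" for a b c :: nat
  define C where "C c = fact c * (fact (y + z - c) :: real)" for c
  have neg: "vten x y z a b c = 0" if "a < 0 \<or> b < 0" for a b c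
    using vten_support[of x y z a b c] that by force
  \<comment> \<open>The two terms of the bracket w1 u2 - u1 w2 applied to \<open>F\<close>; only one
    factor of the square of \<open>G\<close> is split this way.\<close>
  define U where "U a b c = vten x y z (int a) (int b - 1) (int c)" for a b c :: nat
  define V where "V a b c = vten x y z (int a - 1) (int b) (int c)" for a b c :: nat
  have G: "G a b c = U a b c - V a b c" for a b c
    by (simp add: G_def U_def V_def vten_Suc d12_def)
  have U0: "U a 0 c = 0" "V 0 b c = 0" for a b c by (simp_all add: U_def V_def neg)
  have UV0: "U (Suc (x + z)) b c = 0" "V a (Suc (x + y)) c = 0" for a b c
    using vten_support[of x y z "int (Suc (x + z))"] vten_support[of x y z _ "int (Suc (x + y))"]
    by (force simp: U_def V_def)+
  have US: "U a (Suc b) c = F a b c" "V (Suc a) b c = F a b c" for a b c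
    by (simp_all add: U_def V_def F_def)
  define W where "W a b c = (fact a * fact (Suc x + z - a)) * (fact b * fact (Suc x + y - b)) * C c" for a b c :: nat
  define w where "w a b c = (fact a * fact (x + z - a)) * (fact b * fact (x + y - b)) * C c" for a b c :: nat
  \<comment> \<open>\<open>W\<close> and \<open>w\<close> are the weights before and after lowering
    the degrees of legs 1 and 2 by one. Their ratios are exactly the coefficients in
    \<open>cayley\<close>.\<close>
  have W1: "W a (Suc b) c = (real x + 1 + real z - real a) * (real b + 1) * w a b c"
    if "a \<le> x + z" for a b c
    using that by (simp add: W_def w_def Suc_diff_le of_nat_diff algebra_simps)
  have W2: "W (Suc a) b c = (real a + 1) * (real x + 1 + real y - real b) * w a b c"
    if "b \<le> x + y" for a b c
    using that by (simp add: W_def w_def Suc_diff_le of_nat_diff algebra_simps)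
  have "vnorm (Suc x) y z = (\<Sum>a\<le>Suc (x + z). \<Sum>b\<le>Suc (x + y). \<Sum>c\<le>y + z. G a b c * U a b c * W a b c)
     - (\<Sum>a\<le>Suc (x + z). \<Sum>b\<le>Suc (x + y). \<Sum>c\<le>y + z. G a b c * V a b c * W a b c)"
    unfolding sum_subtractf [symmetric] vnorm_def
    by (intro sum.cong) (simp_all add: G_def [symmetric] W_def C_def power2_eq_square
        left_diff_distrib [symmetric] right_diff_distrib [symmetric] G [symmetric] mult_ac)
  \<comment> \<open>After the index shift both sums run over the smaller box belonging to
    \<open>F\<close>: \<open>U\<close> vanishes for b = 0 and for the top value of a,
    \<open>V\<close> for a = 0 and the top value of b.\<close>
  also have "(\<Sum>a\<le>Suc (x + z). \<Sum>b\<le>Suc (x + y). \<Sum>c\<le>y + z. G a b c * U a b c * W a b c)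
     = (\<Sum>a\<le>x + z. \<Sum>b\<le>x + y. \<Sum>c\<le>y + z. G a (Suc b) c * F a b c * W a (Suc b) c)"
    unfolding sum.atMost_Suc[of _ "x + z"]
    by (simp add: sum.atMost_Suc_shift U0 US UV0 del: sum.atMost_Suc)
  also have "(\<Sum>a\<le>Suc (x + z). \<Sum>b\<le>Suc (x + y). \<Sum>c\<le>y + z. G a b c * V a b c * W a b c)
     = (\<Sum>a\<le>x + z. \<Sum>b\<le>x + y. \<Sum>c\<le>y + z. G (Suc a) b c * F a b c * W (Suc a) b c)"
    unfolding sum.atMost_Suc[of _ "x + y"]
    by (simp add: sum.atMost_Suc_shift U0 US UV0 del: sum.atMost_Suc)
  also have "(\<Sum>a\<le>x + z. \<Sum>b\<le>x + y. \<Sum>c\<le>y + z. G a (Suc b) c * F a b c * W a (Suc b) c)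
      - (\<Sum>a\<le>x + z. \<Sum>b\<le>x + y. \<Sum>c\<le>y + z. G (Suc a) b c * F a b c * W (Suc a) b c)
     = (\<Sum>a\<le>x + z. \<Sum>b\<le>x + y. \<Sum>c\<le>y + z.
         cayley (int (Suc x + z)) (int (Suc x + y)) (vten (Suc x) y z) (int a) (int b) (int c)
           * F a b c * w a b c)"
    unfolding sum_subtractf [symmetric]
    by (intro sum.cong refl) (simp add: W1 W2 cayley_def G_def add_ac, algebra)
  also have "\<dots> = of_nat ((x + 1) * (x + y + z + 2)) * vnorm x y z"
    unfolding cayley_vten vnorm_def sum_distrib_left
    by (intro sum.cong) (simp_all add: F_def w_def C_def power2_eq_square mult_ac)
  finally show ?thesis .
qed

lemma vnorm_eq: "vnorm x y z = fact (x + y + z + 1) * fact x * fact y * fact z"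
proof -
  have y: "vnorm x (Suc y) z = of_nat ((y + 1) * (x + y + z + 2)) * vnorm x y z" for x y z
    by (metis vnorm_rotate vnorm_Suc add.commute add.left_commute)
  have z: "vnorm x y (Suc z) = of_nat ((z + 1) * (x + y + z + 2)) * vnorm x y z" for x y z
    by (metis vnorm_rotate vnorm_Suc add.commute add.left_commute)
  show ?thesis
  proof (induction x)
    case 0
    show ?case
    proof (induction y)
      case 0
      show ?case
      proof (induction z)
        case 0
        show ?case by (simp add: vnorm_def vten_0 triv_def)
      next
        case (Suc z)
        then show ?case by (simp add: z algebra_simps)
      qed
    next
      case (Suc y)
      then show ?case by (simp add: y algebra_simps)
    qed
  next
    case (Suc x)
    then show ?case by (simp add: vnorm_Suc algebra_simps)
  qed
qed

section \<open>The vertex tensor as a signed sum over sets of strands\<close>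

lemma sum_Pow_insert:
  assumes "finite A" "a \<notin> A"
  shows "sum f (Pow (insert a A)) = (\<Sum>S\<in>Pow A. f S + f (insert a S))"
proof -
  have "sum f (Pow (insert a A)) = sum f (Pow A) + sum f (insert a ` Pow A)"
    unfolding Pow_insert using assms by (intro sum.union_disjoint) auto
  also have "sum f (insert a ` Pow A) = (\<Sum>S\<in>Pow A. f (insert a S))"
    using assms by (subst sum.reindex) (auto simp: inj_on_def)
  finally show ?thesis by (simp add: sum.distrib)
qed

text \<open>This multiplies out the brackets, one factor for each element of \<open>B1\<close>
  ([12]), \<open>B2\<close> ([23]) and \<open>B3\<close> ([31]). \<open>S\<close> holds the factors
  whose negative term - u_i w_j is chosen, so \<open>u\<close> of leg 1 comes from \<open>S\<close>
  inside \<open>B1\<close> and from the complement of \<open>S\<close> inside \<open>B3\<close>, and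
  cyclically.\<close>

lemma vten_Pow:
  assumes "finite B1" "finite B2" "finite B3" "B1 \<inter> B2 = {}" "B2 \<inter> B3 = {}" "B1 \<inter> B3 = {}"
  shows "(\<Sum>S\<in>Pow (B1 \<union> B2 \<union> B3). (-1) ^ card S * of_bool (a = int (card (S \<inter> B1) + card (B3 - S))
      \<and> b = int (card (S \<inter> B2) + card (B1 - S)) \<and> c = int (card (S \<inter> B3) + card (B2 - S))))
    = vten (card B1) (card B2) (card B3) a b c"
proof -
  define F :: "int \<Rightarrow> int \<Rightarrow> int \<Rightarrow> 'a set \<Rightarrow> 'a set \<Rightarrow> 'a set \<Rightarrow> 'a set \<Rightarrow> real" where
    "F a b c B1 B2 B3 S = (-1) ^ card S * of_bool (a = int (card (S \<inter> B1) + card (B3 - S))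
      \<and> b = int (card (S \<inter> B2) + card (B1 - S)) \<and> c = int (card (S \<inter> B3) + card (B2 - S)))"
    for a b c B1 B2 B3 S
  define G where "G a b c B1 B2 B3 = (\<Sum>S\<in>Pow (B1 \<union> B2 \<union> B3). F a b c B1 B2 B3 S)" for a b c B1 B2 B3
  have rot: "G a b c B1 B2 B3 = G b c a B2 B3 B1" for a b c B1 B2 B3
    unfolding G_def F_def by (intro sum.cong) (auto simp: Un_ac)
  \<comment> \<open>A new factor [12]: leaving \<open>u\<close> out of \<open>S\<close> raises the
    exponent of leg 2, putting it in raises that of leg 1 and changes the sign. By
    \<open>rot\<close> this one case also serves for \<open>B2\<close> and
    \<open>B3\<close>.\<close>
  have step: "G a b c (insert u B1) B2 B3 = G a (b - 1) c B1 B2 B3 - G (a - 1) b c B1 B2 B3"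
    if fin: "finite B1" "finite B2" "finite B3" and u: "u \<notin> B1" "u \<notin> B2" "u \<notin> B3" for a b c u B1 B2 B3
  proof -
    have "F a b c (insert u B1) B2 B3 S = F a (b - 1) c B1 B2 B3 S
        \<and> F a b c (insert u B1) B2 B3 (insert u S) = - F (a - 1) b c B1 B2 B3 S"
      if S: "S \<in> Pow (B1 \<union> B2 \<union> B3)" for S
    proof -
      have uS: "u \<notin> S" and finS: "finite S" using S u fin by (auto intro: finite_subset)
      have "card (insert u B1 - S) = Suc (card (B1 - S))" "S \<inter> insert u B1 = S \<inter> B1"
        using uS u fin by (simp_all add: insert_Diff_if)
      moreover have "card (insert u S \<inter> insert u B1) = Suc (card (S \<inter> B1))"
        "insert u B1 - insert u S = B1 - S" "insert u S \<inter> B2 = S \<inter> B2" "insert u S \<inter> B3 = S \<inter> B3"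
        "B2 - insert u S = B2 - S" "B3 - insert u S = B3 - S" "card (insert u S) = Suc (card S)"
        using uS u fin finS by auto
      ultimately show ?thesis unfolding F_def by (auto simp: algebra_simps)
    qed
    then show ?thesis
      unfolding G_def Un_insert_left using fin u
      by (subst sum_Pow_insert) (simp_all add: sum_subtractf [symmetric])
  qed
  have "G a b c B1 B2 B3 = vten (card B1) (card B2) (card B3) a b c"
    using assms
  proof (induction B1 arbitrary: a b c rule: finite_induct)
    case empty
    then have "finite B2" "B2 \<inter> B3 = {}" by auto
    then show ?case
    proof (induction B2 arbitrary: a b c rule: finite_induct)
      case empty
      show ?case using \<open>finite B3\<close>
      proof (induction B3 arbitrary: a b c rule: finite_induct)
        case empty
        show ?case by (simp add: G_def F_def vten_0 triv_def)
      next
        case (insert u B3)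
        then show ?case
          using step[of B3 "{}" "{}" u c a b] rot[of a b c "{}" "{}" "insert u B3"] rot[of _ _ _ "{}" B3 "{}"] rot[of _ _ _ "{}" "{}" B3]
            rot[of b c a "{}" "insert u B3" "{}"]
          by (simp add: vten_Suc d31_def)
      qed
    next
      case (insert u B2)
      then show ?case
        using step[of B2 B3 "{}" u b c a] rot[of _ _ _ "{}" _ B3] \<open>finite B3\<close> by (simp add: vten_Suc d23_def)
    qed
  next
    case (insert u B1)
    then show ?case using step[of B1 B2 B3 u a b c] by (simp add: vten_Suc d12_def)
  qed
  then show ?thesis unfolding G_def F_def .
qed

text \<open>Distributivity: a subset of a disjoint union is an independent choice of a subset of
  each block.\<close>

lemma sum_Pow_Union:
  fixes F :: "'v \<Rightarrow> 'a set \<Rightarrow> 'b::comm_semiring_1"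
  assumes "finite V" "\<And>v. v \<in> V \<Longrightarrow> finite (B v)" "disjoint_family_on B V"
  shows "(\<Sum>S\<in>Pow (\<Union>v\<in>V. B v). \<Prod>v\<in>V. F v (S \<inter> B v)) = (\<Prod>v\<in>V. \<Sum>S\<in>Pow (B v). F v S)"
  using assms
proof (induction V rule: finite_induct)
  case (insert w V)
  let ?U = "\<Union>v\<in>V. B v"
  have dj: "B w \<inter> ?U = {}" and dj': "disjoint_family_on B V"
    using insert.prems(2) insert.hyps by (auto simp: disjoint_family_on_def)
  have "(\<Sum>S\<in>Pow (\<Union>v\<in>insert w V. B v). \<Prod>v\<in>insert w V. F v (S \<inter> B v))
      = (\<Sum>(S, S')\<in>Pow (B w) \<times> Pow ?U. F w S * (\<Prod>v\<in>V. F v (S' \<inter> B v)))"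
  proof (rule sum.reindex_bij_witness[where i = "\<lambda>(S, S'). S \<union> S'" and j = "\<lambda>S. (S \<inter> B w, S \<inter> ?U)"])
    fix S assume "S \<in> Pow (\<Union>v\<in>insert w V. B v)"
    have "S \<inter> ?U \<inter> B v = S \<inter> B v" if "v \<in> V" for v using that by blast
    then show "(case (S \<inter> B w, S \<inter> ?U) of (S, S') \<Rightarrow> F w S * (\<Prod>v\<in>V. F v (S' \<inter> B v)))
        = (\<Prod>v\<in>insert w V. F v (S \<inter> B v))"
      using insert.hyps by simp
  qed (use dj in auto)
  also have "\<dots> = (\<Sum>S\<in>Pow (B w). F w S) * (\<Sum>S\<in>Pow ?U. \<Prod>v\<in>V. F v (S \<inter> B v))"
    by (simp add: sum.cartesian_product [symmetric] sum_product)
  finally show ?case using insert dj' by simp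
qed simp

section \<open>Contractions of tensors\<close>

lemma sum_PiE_insert:
  assumes "e \<notin> F"
  shows "(\<Sum>\<kappa>\<in>PiE (insert e F) D. f \<kappa>) = (\<Sum>\<kappa>\<in>PiE F D. \<Sum>k\<in>D e. f (\<kappa>(e := k)))"
proof -
  have inj: "inj_on (\<lambda>(y, g). g(e := y)) (D e \<times> PiE F D)"
    using assms by (rule inj_combinator)
  have "(\<Sum>\<kappa>\<in>PiE (insert e F) D. f \<kappa>) = (\<Sum>(k, \<kappa>)\<in>D e \<times> PiE F D. f (\<kappa>(e := k)))"
    unfolding PiE_insert_eq sum.reindex [OF inj] by (simp add: case_prod_unfold)
  also have "\<dots> = (\<Sum>k\<in>D e. \<Sum>\<kappa>\<in>PiE F D. f (\<kappa>(e := k)))"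
    by (simp add: sum.cartesian_product)
  finally show ?thesis by (subst sum.swap)
qed

text \<open>Summing out an edge by the Cauchy--Schwarz inequality replaces the tensors at its two
  ends by their partial \<open>\<ell>\<^sup>2\<close> norms; it needs the two ends to be different vertices.\<close>
lemma tensor_contraction_le:
  fixes f :: "'v \<Rightarrow> ('e \<Rightarrow> 'k) \<Rightarrow> real"
  assumes "finite F" "finite V" "\<And>v \<kappa>. f v \<kappa> \<ge> 0"
    and dep: "\<And>v \<kappa> \<kappa>'. (\<forall>e\<in>E v. \<kappa> e = \<kappa>' e) \<Longrightarrow> f v \<kappa> = f v \<kappa>'"
    and ends: "\<And>e. e \<in> F \<Longrightarrow> \<exists>v w. v \<noteq> w \<and> v \<in> V \<and> w \<in> V \<and> {u \<in> V. e \<in> E u} = {v, w}"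
  shows "(\<Sum>\<kappa>\<in>PiE F D. \<Prod>v\<in>V. f v \<kappa>) \<le> (\<Prod>v\<in>V. L2_set (f v) (PiE (F \<inter> E v) D))"
  using assms(1,3) dep ends
proof (induction F arbitrary: f rule: finite_induct)
  case empty
  then show ?case by (auto simp: L2_set_def intro!: prod_mono)
next
  case (insert e F)
  obtain v w where vw: "v \<noteq> w" "v \<in> V" "w \<in> V" "{u \<in> V. e \<in> E u} = {v, w}"
    using insert.prems(3)[of e] by blast
  define g where "g u \<kappa> = (if e \<in> E u then L2_set (\<lambda>k. f u (\<kappa>(e := k))) (D e) else f u \<kappa>)" for u \<kappa>
  have "(\<Sum>\<kappa>\<in>PiE (insert e F) D. \<Prod>v\<in>V. f v \<kappa>)
      = (\<Sum>\<kappa>\<in>PiE F D. \<Sum>k\<in>D e. \<Prod>v\<in>V. f v (\<kappa>(e := k)))"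
    using insert.hyps by (simp add: sum_PiE_insert)
  also have "\<dots> \<le> (\<Sum>\<kappa>\<in>PiE F D. \<Prod>v\<in>V. g v \<kappa>)"
  proof (rule sum_mono)
    fix \<kappa>
    let ?r = "\<Prod>u\<in>V - {v, w}. f u \<kappa>"
    have split: "(\<Prod>u\<in>V. h u) = h v * h w * (\<Prod>u\<in>V - {v, w}. h u)" for h :: "'v \<Rightarrow> real"
    proof -
      have "(\<Prod>u\<in>V. h u) = (\<Prod>u\<in>{v, w}. h u) * (\<Prod>u\<in>V - {v, w}. h u)"
        using vw \<open>finite V\<close> by (subst prod.subset_diff [of "{v, w}" V]) (auto simp: mult.commute)
      then show ?thesis using vw by simp
    qed
    have nE: "e \<notin> E u" if "u \<in> V - {v, w}" for u using that vw by blast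
    have rest: "f u (\<kappa>(e := k)) = f u \<kappa>" if "u \<in> V - {v, w}" for u k
      using nE[OF that] by (intro insert.prems(2)) auto
    have e: "e \<in> E v" "e \<in> E w" using vw by blast+
    have "(\<Sum>k\<in>D e. \<Prod>u\<in>V. f u (\<kappa>(e := k)))
        = (\<Sum>k\<in>D e. \<bar>f v (\<kappa>(e := k))\<bar> * \<bar>f w (\<kappa>(e := k))\<bar>) * ?r"
      by (simp add: split rest sum_distrib_right insert.prems(1))
    also have "\<dots> \<le> g v \<kappa> * g w \<kappa> * ?r"
      unfolding g_def using e
      by (intro mult_right_mono) (auto intro!: L2_set_mult_ineq prod_nonneg insert.prems(1))
    also have "\<dots> = (\<Prod>u\<in>V. g u \<kappa>)"
      by (simp add: split g_def nE)
    finally show "(\<Sum>k\<in>D e. \<Prod>u\<in>V. f u (\<kappa>(e := k))) \<le> (\<Prod>u\<in>V. g u \<kappa>)" .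
  qed
  also have "\<dots> \<le> (\<Prod>v\<in>V. L2_set (g v) (PiE (F \<inter> E v) D))"
  proof (rule insert.IH)
    show "g u \<kappa> \<ge> 0" for u \<kappa> by (simp add: g_def insert.prems(1) L2_set_nonneg)
    show "g u \<kappa> = g u \<kappa>'" if "\<forall>e\<in>E u. \<kappa> e = \<kappa>' e" for u \<kappa> \<kappa>'
    proof (cases "e \<in> E u")
      case True
      have "f u (\<kappa>(e := k)) = f u (\<kappa>'(e := k))" for k
        using that by (intro insert.prems(2)) auto
      with True show ?thesis by (simp add: g_def)
    qed (use that in \<open>simp add: g_def insert.prems(2)\<close>)
  qed (use insert.prems(3) in blast)
  \<comment> \<open>The norm of the partial norms over the label of \<open>e\<close> is the norm
    over all labels, so nothing is lost here.\<close>
  also have "\<dots> = (\<Prod>v\<in>V. L2_set (f v) (PiE (insert e F \<inter> E v) D))"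
  proof (rule prod.cong)
    fix u
    show "L2_set (g u) (PiE (F \<inter> E u) D) = L2_set (f u) (PiE (insert e F \<inter> E u) D)"
    proof (cases "e \<in> E u")
      case True
      then show ?thesis
        using insert.hyps by (simp add: L2_set_def g_def sum_PiE_insert sum_nonneg)
    next
      case False
      then have "g u = f u" by (simp add: g_def fun_eq_iff)
      with False show ?thesis by simp
    qed
  qed simp
  finally show ?case .
qed

section \<open>Curves formed by two matchings\<close>

definition matching :: "('a \<Rightarrow> 'a) \<Rightarrow> 'a set \<Rightarrow> bool" where
  "matching m P \<longleftrightarrow> (\<forall>x. m (m x) = x) \<and> (\<forall>x. m x \<noteq> x \<longleftrightarrow> x \<in> P)"

text \<open>For \<open>b = True\<close> these are the unions of \<open>m\<close>-orbits, for \<open>b = False\<close> the transversals of the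
  \<open>m\<close>-orbits; treating both at once lets one induction handle curves and their 2-colourings.\<close>
definition link_sets :: "bool \<Rightarrow> ('a \<Rightarrow> 'a) \<Rightarrow> 'a set \<Rightarrow> 'a set set" where
  "link_sets b m P = {X. X \<subseteq> P \<and> (\<forall>x\<in>P. m x \<in> X \<longleftrightarrow> (x \<in> X \<longleftrightarrow> b))}"

text \<open>Removes \<open>x\<close> and \<open>y\<close> from a matching and joins their former partners.\<close>
definition splice :: "('a \<Rightarrow> 'a) \<Rightarrow> 'a \<Rightarrow> 'a \<Rightarrow> 'a \<Rightarrow> 'a" where
  "splice m x y z = (if z = x \<or> z = y then z else if m z = x then m y else if m z = y then m x else m z)"

text \<open>For a common transversal \<open>X\<close> the partner \<open>e x\<close> of a selected
  point is not selected and \<open>v (e x)\<close> is selected again. So \<open>turn\<close> walks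
  along each curve two links at a time and has one cycle in \<open>X\<close> per curve, of half its
  length.\<close>

definition turn :: "('a \<Rightarrow> 'a) \<Rightarrow> ('a \<Rightarrow> 'a) \<Rightarrow> 'a set \<Rightarrow> 'a \<Rightarrow> 'a" where
  "turn e v X x = (if x \<in> X then v (e x) else x)"

lemma matching_invol [simp]: "matching m P \<Longrightarrow> m (m x) = x"
  by (simp add: matching_def)

lemma matching_neq: "matching m P \<Longrightarrow> x \<in> P \<Longrightarrow> m x \<noteq> x"
  by (simp add: matching_def)

lemma matching_fix: "matching m P \<Longrightarrow> x \<notin> P \<Longrightarrow> m x = x"
  by (auto simp: matching_def)

lemma matching_in [simp]: "matching m P \<Longrightarrow> m x \<in> P \<longleftrightarrow> x \<in> P"
  unfolding matching_def by metis

lemma matching_eq_iff: "matching m P \<Longrightarrow> m x = m y \<longleftrightarrow> x = y"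
  unfolding matching_def by metis

lemma matching_permutes: "matching m P \<Longrightarrow> m permutes P"
  by (intro bij_imp_permutes bij_betw_byWitness[where f' = m]) (auto simp: matching_fix)

lemma matching_splice:
  assumes m: "matching m P" and "x \<in> P" "y \<in> P" "x \<noteq> y"
  shows "matching (splice m x y) (P - {x, y})"
proof -
  have inv: "m (m u) = u" for u using m by simp
  have ne: "m u = u \<longleftrightarrow> u \<notin> P" for u using m by (auto simp: matching_def)
  have "splice m x y (splice m x y z) = z \<and> (splice m x y z \<noteq> z \<longleftrightarrow> z \<in> P - {x, y})" for z
  proof -
    consider "z = x \<or> z = y" | "z \<noteq> x" "z \<noteq> y" "m z = x" | "z \<noteq> x" "z \<noteq> y" "m z = y"
      | "z \<noteq> x" "z \<noteq> y" "m z \<noteq> x" "m z \<noteq> y" by blast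
    then show ?thesis
    proof cases
      case 2
      then have z: "z = m x" using inv by metis
      have "m y \<noteq> x" "m y \<noteq> y" "m y \<noteq> m x" "m x \<in> P" using 2 z inv ne assms by metis+
      then show ?thesis using 2 z inv assms(4) by (auto simp: splice_def)
    next
      case 3
      then have z: "z = m y" using inv by metis
      have "m x \<noteq> y" "m x \<noteq> x" "m y \<noteq> m x" "m y \<in> P" using 3 z inv ne assms by metis+
      then show ?thesis using 3 z inv assms(4) by (auto simp: splice_def)
    next
      case 4
      then show ?thesis using inv ne by (auto simp: splice_def)
    qed (auto simp: splice_def)
  qed
  then show ?thesis by (simp add: matching_def)
qed

text \<open>The new link replaces the path m x, x, y, m y. By the last hypothesis x and y behave
  like a link, so the path has three links, and three alternations amount to one; agreement
  (\<open>b = True\<close>) is transitive anyway.\<close>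

lemma link_sets_splice:
  assumes "matching m P" "x \<in> P" "y \<in> P" "x \<noteq> y" "X \<in> link_sets b m P"
    and "y \<in> X \<longleftrightarrow> (x \<in> X \<longleftrightarrow> b)"
  shows "X - {x, y} \<in> link_sets b (splice m x y) (P - {x, y})"
proof -
  have L: "m z \<in> X \<longleftrightarrow> (z \<in> X \<longleftrightarrow> b)" if "z \<in> P" for z
    using assms that by (auto simp: link_sets_def)
  have "splice m x y z \<in> X - {x, y} \<longleftrightarrow> (z \<in> X - {x, y} \<longleftrightarrow> b)" if z: "z \<in> P" "z \<noteq> x" "z \<noteq> y" for z
  proof -
    have inv: "m (m u) = u" for u using assms by simp
    have ne: "m u \<noteq> u" if "u \<in> P" for u using matching_neq[OF assms(1) that] .
    consider "m z = x" | "m z = y" | "m z \<noteq> x" "m z \<noteq> y" by blast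
    then show ?thesis
    proof cases
      case 1
      then have "z = m x" using inv by metis
      moreover have "m y \<noteq> x" "m y \<noteq> y" using z 1 inv ne assms by metis+
      ultimately show ?thesis
        using 1 z L[of z] L[of y] L[of x] assms by (auto simp: splice_def)
    next
      case 2
      then have "z = m y" using inv by metis
      moreover have "m x \<noteq> x" "m x \<noteq> y" using z 2 inv ne assms by metis+
      ultimately show ?thesis
        using 2 z L[of z] L[of y] L[of x] assms by (auto simp: splice_def)
    next
      case 3
      then show ?thesis using z L[of z] by (auto simp: splice_def)
    qed
  qed
  then show ?thesis using assms(5) by (auto simp: link_sets_def)
qed

section \<open>Removing one edge link from a pair of matchings\<close>

context
  fixes e v :: "'a \<Rightarrow> 'a" and P :: "'a set" and x y :: 'a
  assumes e: "matching e P" and v: "matching v P" and x: "x \<in> P" and y: "y = e x"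
begin

lemma partner: "y \<in> P" "x \<noteq> y" "e y = x"
  using e x y matching_neq[OF e x] by auto

lemma link_sets_splice_both:
  assumes "X \<in> link_sets b e P \<inter> link_sets b v P"
  shows "X - {x, y} \<in> link_sets b (splice e x y) (P - {x, y}) \<inter> link_sets b (splice v x y) (P - {x, y})"
proof -
  have "y \<in> X \<longleftrightarrow> (x \<in> X \<longleftrightarrow> b)" using assms x y by (auto simp: link_sets_def)
  then show ?thesis
    using assms link_sets_splice[OF e x partner(1,2)] link_sets_splice[OF v x partner(1,2)] by blast
qed

lemma e_neq: "z \<in> P - {x, y} \<Longrightarrow> e z \<noteq> x \<and> e z \<noteq> y"
  using matching_eq_iff[OF e, of z x] matching_eq_iff[OF e, of z y] partner y by auto

lemma splice_e: "z \<in> P - {x, y} \<Longrightarrow> splice e x y z = e z"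
  using e_neq[of z] by (auto simp: splice_def)

lemma e_notin: "z \<in> P - {x, y} \<Longrightarrow> e z \<in> P - {x, y}"
  using e_neq[of z] e by auto

text \<open>Here x and y form a whole curve, whose colour \<open>t\<close> at x is free and
  determines y: it agrees with x for \<open>b = True\<close> and is opposite for
  \<open>b = False\<close>.\<close>

lemma bij_link_sets_closed:
  assumes vx: "v x = y"
  shows "bij_betw (\<lambda>X. (x \<in> X, X - {x, y})) (link_sets b e P \<inter> link_sets b v P)
     (UNIV \<times> (link_sets b (splice e x y) (P - {x, y}) \<inter> link_sets b (splice v x y) (P - {x, y})))"
    (is "bij_betw ?f ?L (UNIV \<times> ?L')")
proof (rule bij_betw_byWitness[where f' = "\<lambda>(t, X). X \<union> {z. z = x \<and> t \<or> z = y \<and> t = b}"])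
  have vy: "v y = x" using vx v by auto
  have sv: "splice v x y z = v z" "v z \<in> P - {x, y}" if "z \<in> P - {x, y}" for z
  proof -
    have "v (v z) = z" using v by simp
    then have "v z \<noteq> x" "v z \<noteq> y" using that vx vy by auto
    then show "splice v x y z = v z" "v z \<in> P - {x, y}" using that v by (simp_all add: splice_def)
  qed
  show "?f ` ?L \<subseteq> UNIV \<times> ?L'" using link_sets_splice_both by blast
  show "(\<lambda>(t, X). X \<union> {z. z = x \<and> t \<or> z = y \<and> t = b}) ` (UNIV \<times> ?L') \<subseteq> ?L"
  proof clarify
    fix t X assume X: "X \<in> link_sets b (splice e x y) (P - {x, y})" "X \<in> link_sets b (splice v x y) (P - {x, y})"
    let ?Y = "X \<union> {z. z = x \<and> t \<or> z = y \<and> t = b}"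
    have sub: "X \<subseteq> P - {x, y}" using X by (auto simp: link_sets_def)
    have *: "e z \<in> ?Y \<longleftrightarrow> (z \<in> ?Y \<longleftrightarrow> b)" "v z \<in> ?Y \<longleftrightarrow> (z \<in> ?Y \<longleftrightarrow> b)" if z: "z \<in> P" for z
    proof -
      consider "z = x" | "z = y" | "z \<in> P - {x, y}" using z by blast
      then have "(e z \<in> ?Y \<longleftrightarrow> (z \<in> ?Y \<longleftrightarrow> b)) \<and> (v z \<in> ?Y \<longleftrightarrow> (z \<in> ?Y \<longleftrightarrow> b))"
      proof cases
        case 3
        have "splice e x y z \<in> X \<longleftrightarrow> (z \<in> X \<longleftrightarrow> b)" "splice v x y z \<in> X \<longleftrightarrow> (z \<in> X \<longleftrightarrow> b)"
          using X 3 unfolding link_sets_def by blast+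
        then have "e z \<in> X \<longleftrightarrow> (z \<in> X \<longleftrightarrow> b)" "v z \<in> X \<longleftrightarrow> (z \<in> X \<longleftrightarrow> b)"
          using splice_e[OF 3] sv(1)[OF 3] by simp_all
        then show ?thesis using 3 e_notin[OF 3] sv(2)[OF 3] by blast
      next
        case 1
        have "e z = y" "v z = y" "z \<notin> X" "y \<notin> X" using 1 y vx sub by auto
        then show ?thesis using 1 partner(2) by (cases t; cases b) simp_all
      next
        case 2
        have "e z = x" "v z = x" "z \<notin> X" "x \<notin> X" using 2 partner vy sub by auto
        then show ?thesis using 2 partner(2) by (cases t; cases b) simp_all
      qed
      then show "e z \<in> ?Y \<longleftrightarrow> (z \<in> ?Y \<longleftrightarrow> b)" "v z \<in> ?Y \<longleftrightarrow> (z \<in> ?Y \<longleftrightarrow> b)" by auto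
    qed
    then show "?Y \<in> ?L" using sub x partner by (auto simp: link_sets_def)
  qed
  show "\<forall>X\<in>?L. (\<lambda>(t, X). X \<union> {z. z = x \<and> t \<or> z = y \<and> t = b}) (?f X) = X"
  proof
    fix X assume X: "X \<in> ?L"
    have "y \<in> X \<longleftrightarrow> (x \<in> X \<longleftrightarrow> b)" using X x y by (auto simp: link_sets_def)
    then show "(\<lambda>(t, X). X \<union> {z. z = x \<and> t \<or> z = y \<and> t = b}) (?f X) = X" by auto
  qed
  show "\<forall>a\<in>UNIV \<times> ?L'. ?f ((\<lambda>(t, X). X \<union> {z. z = x \<and> t \<or> z = y \<and> t = b}) a) = a"
    using partner(2) by (auto simp: link_sets_def)
qed

text \<open>Here the curve survives with two points fewer. The colours of x and y are recovered from
  their \<open>v\<close>-partners, which both remain and are joined by the spliced link, so the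
  recovered colours are consistent across the link from x to y.\<close>

lemma bij_link_sets_open:
  assumes vx: "v x \<noteq> y"
  shows "bij_betw (\<lambda>X. X - {x, y}) (link_sets b e P \<inter> link_sets b v P)
     (link_sets b (splice e x y) (P - {x, y}) \<inter> link_sets b (splice v x y) (P - {x, y}))"
    (is "bij_betw ?f ?L ?L'")
proof (rule bij_betw_byWitness[where f' = "\<lambda>X. X \<union> {z. (z = x \<or> z = y) \<and> (v z \<in> X \<longleftrightarrow> b)}"])
  have inv: "v (v u) = u" for u using v by simp
  have ne: "v x \<noteq> x" "v y \<noteq> y" using matching_neq[OF v] x partner by blast+
  have vy: "v y \<noteq> x" using vx inv by metis
  have vP: "v x \<in> P - {x, y}" "v y \<in> P - {x, y}" using v x partner ne vx vy by auto
  show "?f ` ?L \<subseteq> ?L'" using link_sets_splice_both by blast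
  show "(\<lambda>X. X \<union> {z. (z = x \<or> z = y) \<and> (v z \<in> X \<longleftrightarrow> b)}) ` ?L' \<subseteq> ?L"
  proof clarify
    fix X assume X: "X \<in> link_sets b (splice e x y) (P - {x, y})" "X \<in> link_sets b (splice v x y) (P - {x, y})"
    let ?Y = "X \<union> {z. (z = x \<or> z = y) \<and> (v z \<in> X \<longleftrightarrow> b)}"
    have sub: "X \<subseteq> P - {x, y}" using X by (auto simp: link_sets_def)
    have le: "splice e x y z \<in> X \<longleftrightarrow> (z \<in> X \<longleftrightarrow> b)" and lv: "splice v x y z \<in> X \<longleftrightarrow> (z \<in> X \<longleftrightarrow> b)"
      if "z \<in> P - {x, y}" for z
      using X that unfolding link_sets_def by blast+
    have "splice v x y (v x) = v y" using ne vx inv by (simp add: splice_def)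
    then have vyx: "v y \<in> X \<longleftrightarrow> (v x \<in> X \<longleftrightarrow> b)" using lv[OF vP(1)] by simp
    have *: "(e z \<in> ?Y \<longleftrightarrow> (z \<in> ?Y \<longleftrightarrow> b)) \<and> (v z \<in> ?Y \<longleftrightarrow> (z \<in> ?Y \<longleftrightarrow> b))" if z: "z \<in> P" for z
    proof -
      consider "z = x" | "z = y" | "z = v x" | "z = v y" | "z \<in> P - {x, y}" "v z \<noteq> x" "v z \<noteq> y"
        using z inv[of z] by fastforce
      then show ?thesis
      proof cases
        case 3
        have "e z \<in> X \<longleftrightarrow> (z \<in> X \<longleftrightarrow> b)"
          using le[of z] splice_e[of z] vP 3 by simp
        moreover have "e z \<notin> {x, y}" "z \<notin> {x, y}" "v z = x" using 3 vP e_notin[of z] inv[of x] by simp_all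
        ultimately show ?thesis using partner(2) 3 sub by auto
      next
        case 4
        have "e z \<in> X \<longleftrightarrow> (z \<in> X \<longleftrightarrow> b)"
          using le[of z] splice_e[of z] vP 4 by simp
        moreover have "e z \<notin> {x, y}" "z \<notin> {x, y}" "v z = y" using 4 vP e_notin[of z] inv[of y] by simp_all
        ultimately show ?thesis using partner(2) 4 sub by auto
      next
        case 5
        have "splice v x y z = v z" using 5 by (auto simp: splice_def)
        then have "e z \<in> X \<longleftrightarrow> (z \<in> X \<longleftrightarrow> b)" "v z \<in> X \<longleftrightarrow> (z \<in> X \<longleftrightarrow> b)"
          using le[OF 5(1)] lv[OF 5(1)] splice_e[OF 5(1)] by simp_all
        then show ?thesis using 5 e_notin[OF 5(1)] by blast
      next
        case 1
        have "e z = y" "z \<notin> X" "y \<notin> X" "v z \<notin> {x, y}" using 1 y sub vP by auto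
        then show ?thesis using 1 partner(2) vyx by auto
      next
        case 2
        have "e z = x" "z \<notin> X" "x \<notin> X" "v z \<notin> {x, y}" using 2 partner sub vP by auto
        then show ?thesis using 2 partner(2) vyx by auto
      qed
    qed
    have "?Y \<subseteq> P" using sub x partner(1) by blast
    with * show "?Y \<in> ?L" unfolding link_sets_def by blast
  qed
  show "\<forall>X\<in>?L. ?f X \<union> {z. (z = x \<or> z = y) \<and> (v z \<in> ?f X \<longleftrightarrow> b)} = X"
  proof
    fix X assume X: "X \<in> ?L"
    have "v x \<in> X \<longleftrightarrow> (x \<in> X \<longleftrightarrow> b)" "v y \<in> X \<longleftrightarrow> (y \<in> X \<longleftrightarrow> b)"
      using X x partner(1) unfolding link_sets_def by blast+
    moreover have "v x \<in> ?f X \<longleftrightarrow> v x \<in> X" "v y \<in> ?f X \<longleftrightarrow> v y \<in> X" using vP by blast+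
    ultimately have "v z \<in> ?f X \<longleftrightarrow> (z \<in> X \<longleftrightarrow> b)" if "z = x \<or> z = y" for z
      using that by (elim disjE) (simp_all only:)
    then have "{z. (z = x \<or> z = y) \<and> (v z \<in> ?f X \<longleftrightarrow> b)} = X \<inter> {x, y}" by blast
    then show "?f X \<union> {z. (z = x \<or> z = y) \<and> (v z \<in> ?f X \<longleftrightarrow> b)} = X" by blast
  qed
  show "\<forall>X\<in>?L'. ?f (X \<union> {z. (z = x \<or> z = y) \<and> (v z \<in> X \<longleftrightarrow> b)}) = X"
  proof
    fix X assume "X \<in> ?L'"
    then have "X \<subseteq> P - {x, y}" unfolding link_sets_def by blast
    then show "?f (X \<union> {z. (z = x \<or> z = y) \<and> (v z \<in> X \<longleftrightarrow> b)}) = X" by blast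
  qed
qed

end

section \<open>Signs of the permutations attached to two matchings\<close>

lemma turn_permutes:
  assumes e: "matching e P" and v: "matching v P"
    and X: "X \<in> link_sets False e P \<inter> link_sets False v P"
  shows "turn e v X permutes X"
proof (rule bij_imp_permutes)
  have L: "X \<subseteq> P" "\<And>z. z \<in> P \<Longrightarrow> e z \<in> X \<longleftrightarrow> z \<notin> X" "\<And>z. z \<in> P \<Longrightarrow> v z \<in> X \<longleftrightarrow> z \<notin> X"
    using X by (auto simp: link_sets_def)
  show "bij_betw (turn e v X) X X"
  proof (rule bij_betw_byWitness[where f' = "\<lambda>x. e (v x)"])
    have "v (e z) \<in> X" "e (v z) \<in> X" if "z \<in> X" for z
      using that L(1) L(2)[of z] L(2)[of "v z"] L(3)[of z] L(3)[of "e z"] e v by auto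
    then show "turn e v X ` X \<subseteq> X" "(\<lambda>x. e (v x)) ` X \<subseteq> X"
      "\<forall>a\<in>X. turn e v X (e (v a)) = a" "\<forall>a\<in>X. e (v (turn e v X a)) = a"
      using e v by (auto simp: turn_def)
  qed
qed (simp add: turn_def)

text \<open>Composing with the transposition of x and its image \<open>v y\<close> cuts x out of its
  cycle: x becomes fixed and its predecessor goes directly to \<open>v y\<close>. The assumption
  \<open>v x \<noteq> y\<close> makes this a genuine transposition.\<close>

lemma sign_turn_splice_aux:
  assumes e: "matching e P" and v: "matching v P" and x: "x \<in> P" and y: "y = e x" and vx: "v x \<noteq> y"
    and X: "X \<in> link_sets False e P \<inter> link_sets False v P" and xX: "x \<in> X" and fin: "finite P"
  shows "sign (turn (splice e x y) (splice v x y) (X - {x, y})) = - sign (turn e v X)"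
proof -
  have L: "X \<subseteq> P" "\<And>z. z \<in> P \<Longrightarrow> e z \<in> X \<longleftrightarrow> z \<notin> X" "\<And>z. z \<in> P \<Longrightarrow> v z \<in> X \<longleftrightarrow> z \<notin> X"
    using X by (auto simp: link_sets_def)
  have partner: "y \<in> P" "y \<notin> X" "x \<noteq> y" "e y = x" using e x y L(2)[OF x] xX by auto
  have inv: "v (v u) = u" "e (e u) = u" for u using v e by auto
  have vy: "v y \<noteq> x" using vx inv by metis
  have vyX: "v y \<in> X" using L(3)[OF partner(1)] partner by blast
  have "turn (splice e x y) (splice v x y) (X - {x, y}) = transpose x (v y) \<circ> turn e v X"
  proof
    fix z
    consider "z = x" | "z \<notin> X" | "z \<in> X" "z \<noteq> x" by blast
    then show "turn (splice e x y) (splice v x y) (X - {x, y}) z = (transpose x (v y) \<circ> turn e v X) z"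
    proof cases
      case 1
      then show ?thesis using xX y by (simp add: turn_def)
    next
      case 2
      then have "z \<noteq> x" "z \<noteq> v y" using xX vyX by auto
      then show ?thesis using 2 by (simp add: turn_def)
    next
      case 3
      have zy: "z \<noteq> y" using 3 partner by auto
      have ez: "e z \<noteq> y" "e z \<noteq> x" using 3 zy y inv(2) partner by metis+
      have se: "splice e x y z = e z" using 3 zy ez by (simp add: splice_def)
      have "v (e z) \<noteq> v y" using ez inv by metis
      moreover have "v (e z) \<noteq> y"
        using L(3)[of "e z"] L(2)[of z] 3 L(1) partner(2) e by auto
      ultimately show ?thesis
        using 3 zy ez se by (auto simp: turn_def splice_def transpose_def)
    qed
  qed
  moreover have "permutation (turn e v X)"
    using turn_permutes[OF e v X] L(1) fin finite_subset permutation_permutes by metis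
  ultimately show ?thesis
    using vy by (simp add: sign_compose permutation_swap_id sign_swap_id)
qed

lemma splice_commute: "splice m x y = splice m y x" if "x \<noteq> y"
  using that by (auto simp: splice_def fun_eq_iff)

text \<open>Exactly one of x and y is selected, and splicing is symmetric in them, so the selected
  one can play the part of x.\<close>

lemma sign_turn_splice:
  assumes e: "matching e P" and v: "matching v P" and x: "x \<in> P" and y: "y = e x" and vx: "v x \<noteq> y"
    and X: "X \<in> link_sets False e P \<inter> link_sets False v P" and fin: "finite P"
  shows "sign (turn (splice e x y) (splice v x y) (X - {x, y})) = - sign (turn e v X)"
proof (cases "x \<in> X")
  case True
  then show ?thesis using sign_turn_splice_aux[OF e v x y vx X _ fin] by blast
next
  case False
  then have "y \<in> X" using X x y by (auto simp: link_sets_def)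
  moreover have "x = e y" "v y \<noteq> x" using y e vx v by (metis matching_invol)+
  moreover have "y \<in> P" "x \<noteq> y" using x y e matching_neq[OF e x] by auto
  ultimately show ?thesis
    using sign_turn_splice_aux[OF e v, of y x X] X fin splice_commute[of x y]
    by (simp add: insert_commute)
qed

text \<open>The selected point of a two-point curve is already a fixed point of \<open>turn\<close>,
  so deleting the curve changes nothing.\<close>

lemma turn_splice_closed:
  assumes e: "matching e P" and v: "matching v P" and x: "x \<in> P" and y: "y = e x" and vx: "v x = y"
    and X: "X \<in> link_sets False e P \<inter> link_sets False v P"
  shows "turn (splice e x y) (splice v x y) (X - {x, y}) = turn e v X"
proof
  fix z
  have inv: "v (v u) = u" "e (e u) = u" for u using v e by auto
  have vy: "v y = x" "e y = x" using vx y inv by metis+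
  have "e z \<noteq> x" "e z \<noteq> y" if "z \<noteq> x" "z \<noteq> y" using that inv vy y by metis+
  moreover have "v (e z) \<noteq> x" "v (e z) \<noteq> y" if "z \<noteq> x" "z \<noteq> y" using that inv vy y vx by metis+
  ultimately show "turn (splice e x y) (splice v x y) (X - {x, y}) z = turn e v X z"
    using vx vy y by (auto simp: turn_def splice_def)
qed

text \<open>The number of curves formed by two matchings is the \<open>N\<close> with \<open>2 ^ N\<close> unions of curves;
  each curve has exactly two alternating 2-colourings.\<close>
lemma sum_sign_turn:
  assumes "finite P" "matching e P" "matching v P"
  shows "\<exists>N. card (link_sets True e P \<inter> link_sets True v P) = 2 ^ N \<and>
     (\<Sum>X\<in>link_sets False e P \<inter> link_sets False v P. sign (turn e v X)) = (-1) ^ (card P div 2) * (-2) ^ N"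
  using assms
proof (induction "card P" arbitrary: P e v rule: less_induct)
  case less
  note e = less.prems(2) and v = less.prems(3)
  show ?case
  proof (cases "P = {}")
    case True
    have "link_sets b m {} = {{}}" for b and m :: "'a \<Rightarrow> 'a" by (auto simp: link_sets_def)
    moreover have "turn e v {} = id" by (auto simp: turn_def)
    ultimately show ?thesis using True by (intro exI[of _ 0]) simp
  next
    case False
    then obtain x where x: "x \<in> P" by blast
    define y where y: "y = e x"
    define e' v' P' where e': "e' = splice e x y" and v': "v' = splice v x y" and P': "P' = P - {x, y}"
    have partner: "y \<in> P" "x \<noteq> y" using x y e matching_neq[OF e x] by auto
    have m: "matching e' P'" "matching v' P'"
      unfolding e' v' P' using matching_splice e v x partner by metis+
    have c: "card P = Suc (Suc (card P'))"
      using card_Suc_Diff1[of P x] card_Suc_Diff1[of "P - {x}" y] less.prems(1) x partner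
      unfolding P' by (simp add: Diff_insert2 [symmetric])
    have finP': "finite P'" using less.prems(1) P' by simp
    obtain N where N: "card (link_sets True e' P' \<inter> link_sets True v' P') = 2 ^ N"
      "(\<Sum>X\<in>link_sets False e' P' \<inter> link_sets False v' P'. sign (turn e' v' X)) = (-1) ^ (card P' div 2) * (-2) ^ N"
      using less.hyps[OF _ finP' m] c by auto
    \<comment> \<open>Half the number of points drops by one, a factor -1. A closed curve doubles
      the sum, and 2 = (-1)(-2) raises N by one; in the open case the sign of \<open>turn\<close>
      changes instead and N stays.\<close>
    show ?thesis
    proof (cases "v x = y")
      case True
      note bij = bij_link_sets_closed[OF e v x y True, folded e' v' P']
      have "card (link_sets True e P \<inter> link_sets True v P) = 2 ^ Suc N"
        using bij_betw_same_card[OF bij[of True]] N(1) by (simp add: card_cartesian_product)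
      moreover have "(\<Sum>X\<in>link_sets False e P \<inter> link_sets False v P. sign (turn e v X))
          = (\<Sum>X\<in>link_sets False e P \<inter> link_sets False v P. sign (turn e' v' (snd (x \<in> X, X - {x, y}))))"
        by (intro sum.cong) (simp_all add: turn_splice_closed[OF e v x y True] e' v')
      moreover have "\<dots> = (\<Sum>a\<in>(UNIV :: bool set) \<times> (link_sets False e' P' \<inter> link_sets False v' P'). sign (turn e' v' (snd a)))"
        by (rule sum.reindex_bij_betw[OF bij[of False]])
      moreover have "\<dots> = 2 * (\<Sum>X\<in>link_sets False e' P' \<inter> link_sets False v' P'. sign (turn e' v' X))"
        by (simp add: sum.cartesian_product' UNIV_bool)
      ultimately show ?thesis using N(2) c by (intro exI[of _ "Suc N"]) simp
    next
      case False
      note bij = bij_link_sets_open[OF e v x y False, folded e' v' P']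
      have "card (link_sets True e P \<inter> link_sets True v P) = 2 ^ N"
        using bij_betw_same_card[OF bij[of True]] N(1) by simp
      moreover have "(\<Sum>X\<in>link_sets False e P \<inter> link_sets False v P. sign (turn e v X))
          = (\<Sum>X\<in>link_sets False e P \<inter> link_sets False v P. - sign (turn e' v' (X - {x, y})))"
        by (intro sum.cong) (simp_all add: sign_turn_splice[OF e v x y False _ less.prems(1)] e' v')
      moreover have "\<dots> = (\<Sum>X\<in>link_sets False e' P' \<inter> link_sets False v' P'. - sign (turn e' v' X))"
        by (rule sum.reindex_bij_betw[OF bij[of False]])
      ultimately show ?thesis using N(2) c by (intro exI[of _ N]) (simp add: sum_negf)
    qed
  qed
qed

text \<open>Commuting with \<open>e\<close>, the permutation acts on the complement of
  \<open>A\<close> in \<open>P\<close> as the \<open>e\<close>-conjugate of its action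
  \<open>p\<close> on \<open>A\<close>. The two parts have equal signs, which cancel.\<close>

lemma sign_commute_matching_fix:
  assumes e: "matching e P" and fin: "finite P" and z: "z permutes P" and comm: "\<And>x. z (e x) = e (z x)"
    and A: "A \<in> link_sets False e P" and zA: "z ` A = A"
  shows "sign z = 1"
proof -
  have AP: "A \<subseteq> P" and eA: "\<And>x. x \<in> P \<Longrightarrow> e x \<in> A \<longleftrightarrow> x \<notin> A"
    using A by (auto simp: link_sets_def)
  define p where "p = (\<lambda>x. if x \<in> A then z x else x)"
  have inj: "inj z" using z by (rule permutes_inj)
  have p: "p permutes A"
  proof (rule bij_imp_permutes)
    have "bij_betw z A A" using zA inj by (metis bij_betw_def inj_on_subset subset_UNIV)
    then show "bij_betw p A A" by (rule bij_betw_cong[THEN iffD1, rotated]) (simp add: p_def)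
  qed (simp add: p_def)
  have zAiff: "z x \<in> A \<longleftrightarrow> x \<in> A" for x
    using zA inj by (metis imageE image_eqI inj_def)
  have "z = p \<circ> (e \<circ> p \<circ> e)"
  proof
    fix x
    consider "x \<in> A" | "x \<in> P - A" | "x \<notin> P" by blast
    then show "z x = (p \<circ> (e \<circ> p \<circ> e)) x"
    proof cases
      case 1
      then show ?thesis using eA[of x] AP e by (auto simp: p_def)
    next
      case 2
      then have "e x \<in> A" "z x \<notin> A" using eA[of x] zAiff[of x] by auto
      then show ?thesis using e comm[of x] by (simp add: p_def)
    next
      case 3
      then have "x \<notin> A" "e x = x" "z x = x"
        using AP matching_fix[OF e] permutes_not_in[OF z] by auto
      then show ?thesis by (simp add: p_def)
    qed
  qed
  moreover have "permutation p" "permutation e"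
    using p matching_permutes[OF e] fin AP finite_subset permutation_permutes by metis+
  ultimately have "sign z = sign p * (sign e * sign p * sign e)"
    by (simp add: sign_compose permutation_compose)
  then show ?thesis by (simp add: mult_ac)
qed

text \<open>The centralizer of \<open>e\<close> is a hyperoctahedral group: its elements permute the
  pairs and flip some of them. Relative to the representatives in \<open>A\<close>, the exponent
  counts the flips; permuting whole pairs is even.\<close>

lemma sign_commute_matching:
  assumes e: "matching e P" and fin: "finite P" and z: "z permutes P" and comm: "\<And>x. z (e x) = e (z x)"
    and A: "A \<in> link_sets False e P"
  shows "sign z = (-1) ^ card (A - z ` A)"
  using z comm
proof (induction "card (A - z ` A)" arbitrary: z)
  case 0
  have AP: "A \<subseteq> P" using A by (auto simp: link_sets_def)
  then have finA: "finite A" using fin finite_subset by blast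
  then have "A \<subseteq> z ` A" using 0(1) by auto
  moreover have "card (z ` A) = card A"
    using permutes_inj[OF 0(2)] by (metis card_image inj_on_subset subset_UNIV)
  ultimately have "z ` A = A" using finA by (metis card_subset_eq finite_imageI)
  then show ?case using sign_commute_matching_fix[OF e fin 0(2,3) A] 0(1) by simp
next
  case (Suc n)
  have AP: "A \<subseteq> P" and eA: "\<And>x. x \<in> P \<Longrightarrow> e x \<in> A \<longleftrightarrow> x \<notin> A"
    using A by (auto simp: link_sets_def)
  then have finA: "finite A" using fin finite_subset by blast
  have "card (A - z ` A) \<noteq> 0" using Suc(2) by simp
  then obtain a where a: "a \<in> A" "a \<notin> z ` A" by (metis card.empty DiffE all_not_in_conv)
  have aP: "a \<in> P" using a AP by blast
  obtain b where b: "z b = a" "b \<in> P" using Suc(3) aP by (metis permutes_in_image permutes_def)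
  have "b \<notin> A" using a b by blast
  then have "e b \<in> A" using eA b by blast
  moreover have "z (e b) = e a" using Suc(4) b by simp
  ultimately have ea: "e a \<in> z ` A" by (metis imageI)
  \<comment> \<open>Since \<open>a\<close> is missed by the image of \<open>A\<close>, its partner
    \<open>e a\<close> is hit. Swapping the two afterwards commutes with \<open>e\<close> and undoes
    one flip.\<close>
  define t where "t = transpose a (e a)"
  have ne: "a \<noteq> e a" using matching_neq[OF e aP] by metis
  have te: "t (e x) = e (t x)" for x
    using e ne matching_eq_iff[OF e, of x a] matching_eq_iff[OF e, of x "e a"]
    by (cases "x = a"; cases "x = e a") (auto simp: t_def transpose_def)
  have tz: "(t \<circ> z) permutes P"
    unfolding t_def using Suc(3) aP e by (intro permutes_compose permutes_swap_id) auto
  have img: "(t \<circ> z) ` A = insert a (z ` A - {e a})"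
    using ea a ne unfolding t_def image_comp [symmetric] by (auto simp: transpose_def image_iff split: if_splits)
  have "e a \<notin> A" using eA aP a by blast
  then have "A - (t \<circ> z) ` A = (A - z ` A) - {a}" unfolding img by auto
  then have "card (A - (t \<circ> z) ` A) = n"
    using Suc(2) a finA by (simp add: card_Diff_singleton)
  then have "sign (t \<circ> z) = (-1) ^ n" using Suc(1)[OF _ tz] te Suc(4) by simp
  moreover have "sign (t \<circ> z) = - sign z"
    using Suc(3) fin ne permutation_permutes unfolding t_def
    by (subst sign_compose) (auto simp: permutation_swap_id sign_swap_id)
  ultimately show ?case using Suc(2) by (metis add.inverse_inverse mult_minus1 power_Suc)
qed

text \<open>\<open>X\<close> contains one point of each pair. Where \<open>A\<close> and
  \<open>B\<close> choose different points, exactly one of them lies in \<open>X\<close>; where they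
  agree, the contribution is 0 or 2.\<close>

lemma card_transversals_parity:
  assumes e: "matching e P" and fin: "finite P"
    and A: "A \<in> link_sets False e P" and B: "B \<in> link_sets False e P" and X: "X \<in> link_sets False e P"
  shows "(-1 :: int) ^ card (A - B) = (-1) ^ (card (A \<inter> X) + card (B \<inter> X))"
proof -
  have sub: "A \<subseteq> P" "B \<subseteq> P" and L: "\<And>x. x \<in> P \<Longrightarrow> e x \<in> A \<longleftrightarrow> x \<notin> A"
    "\<And>x. x \<in> P \<Longrightarrow> e x \<in> B \<longleftrightarrow> x \<notin> B" "\<And>x. x \<in> P \<Longrightarrow> e x \<in> X \<longleftrightarrow> x \<notin> X"
    using A B X by (auto simp: link_sets_def)
  have finAB: "finite A" "finite B" using sub fin finite_subset by blast+
  have "bij_betw e ((A - B) - X) ((B - A) \<inter> X)"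
    by (rule bij_betw_byWitness[where f' = e]) (use e sub L in auto)
  then have c: "card ((B - A) \<inter> X) = card ((A - B) - X)" by (metis bij_betw_same_card)
  have "card (A \<inter> X) = card (A \<inter> B \<inter> X) + card ((A - B) \<inter> X)"
    using finAB by (subst card_Un_disjoint [symmetric]) (auto intro: arg_cong[where f = card])
  moreover have "card (B \<inter> X) = card (A \<inter> B \<inter> X) + card ((B - A) \<inter> X)"
    using finAB by (subst card_Un_disjoint [symmetric]) (auto intro: arg_cong[where f = card])
  moreover have "card (A - B) = card ((A - B) \<inter> X) + card ((A - B) - X)"
    using finAB by (subst card_Un_disjoint [symmetric]) (auto intro: arg_cong[where f = card])
  ultimately have "card (A \<inter> X) + card (B \<inter> X) = 2 * card (A \<inter> B \<inter> X) + card (A - B)"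
    using c by simp
  then show ?thesis by (simp add: power_add power_mult)
qed

text \<open>Both \<open>p\<close> and \<^term>\<open>turn e v X\<close> conjugate \<open>e\<close> into \<open>v\<close>, so they differ by a permutation that
  commutes with \<open>e\<close>.\<close>
lemma sign_conjugator:
  assumes e: "matching e P" and v: "matching v P" and fin: "finite P"
    and p: "p permutes P" and conj: "\<And>x. p (e x) = v (p x)"
    and A: "A \<in> link_sets False e P" and B: "B \<in> link_sets False v P" and pA: "p ` A = B"
    and X: "X \<in> link_sets False e P \<inter> link_sets False v P"
  shows "sign (turn e v X) = sign p * (-1) ^ (card (A \<inter> X) + card (B \<inter> X))"
proof -
  define q where "q = turn e v X"
  have XP: "X \<subseteq> P" and eX: "\<And>z. z \<in> P \<Longrightarrow> e z \<in> X \<longleftrightarrow> z \<notin> X" using X by (auto simp: link_sets_def)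
  have qX: "q permutes X" unfolding q_def using turn_permutes[OF e v X] .
  have q: "q permutes P" using qX XP by (rule permutes_subset)
  have qe: "q (e x) = v (q x)" for x
    using eX[of x] e v XP matching_fix[OF e, of x] matching_fix[OF v, of x]
    by (cases "x \<in> P") (auto simp: q_def turn_def)
  define z where "z = inv q \<circ> p"
  have iq: "inv q permutes P" using q by (rule permutes_inv)
  have qi: "q (inv q x) = x" "inv q (q x) = x" for x using permutes_inverses[OF q] by auto
  have z: "z permutes P" unfolding z_def by (rule permutes_compose[OF p iq])
  have comm: "z (e x) = e (z x)" for x
    unfolding z_def using conj[of x] qe[of "inv q (p x)"] qi by (metis comp_apply)
  have perm: "permutation p" "permutation (inv q)" "permutation q"
    using p iq q fin permutation_permutes by metis+
  have sz: "sign z = sign q * sign p" unfolding z_def by (simp add: sign_compose sign_inverse perm)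
  define B' where "B' = inv q ` B"
  have zA: "z ` A = B'" unfolding z_def B'_def using pA by (metis image_comp)
  have inB': "x \<in> B' \<longleftrightarrow> q x \<in> B" for x unfolding B'_def using qi by (metis image_iff)
  have B'P: "B' \<in> link_sets False e P"
    using B inB' qe permutes_in_image[OF q] by (auto simp: link_sets_def)
  \<comment> \<open>\<open>q\<close> maps \<open>X\<close> onto itself, so pulling \<open>B\<close>
    back to a transversal of \<open>e\<close> does not change the number of its points in
    \<open>X\<close>.\<close>
  have "bij_betw q (B' \<inter> X) (B \<inter> X)"
    by (rule bij_betw_byWitness[where f' = "inv q"])
      (use qi inB' permutes_in_image[OF qX] permutes_in_image[OF permutes_inv[OF qX]] in auto)
  then have "card (B' \<inter> X) = card (B \<inter> X)" by (rule bij_betw_same_card)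
  then have "sign z = (-1) ^ (card (A \<inter> X) + card (B \<inter> X))"
    using sign_commute_matching[OF e fin z comm A] card_transversals_parity[OF e fin A B'P, of X] X zA by simp
  then have "sign p * (-1) ^ (card (A \<inter> X) + card (B \<inter> X)) = sign p * sign z" by simp
  also have "\<dots> = sign q" by (simp add: sz mult.left_commute)
  finally show ?thesis by (simp add: q_def)
qed

text \<open>Both transversals contain half of \<open>P\<close>; any bijection between them extends
  to the partners by compatibility with the matchings.\<close>

lemma ex_conjugator:
  assumes e: "matching e P" and v: "matching v P" and fin: "finite P"
    and A: "A \<in> link_sets False e P" and B: "B \<in> link_sets False v P"
  shows "\<exists>p. p permutes P \<and> (\<forall>x. p (e x) = v (p x)) \<and> p ` A = B"
proof -
  have half: "2 * card C = card P" if m: "matching m P" and C: "C \<in> link_sets False m P" for m and C :: "'a set"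
  proof -
    have sub: "C \<subseteq> P" and L: "\<And>x. x \<in> P \<Longrightarrow> m x \<in> C \<longleftrightarrow> x \<notin> C" using C by (auto simp: link_sets_def)
    have "bij_betw m C (P - C)"
      by (rule bij_betw_byWitness[where f' = m]) (use m sub L in auto)
    then have "card C = card (P - C)" by (rule bij_betw_same_card)
    moreover have "card (P - C) = card P - card C" "card C \<le> card P"
      using sub fin by (auto simp: card_Diff_subset finite_subset card_mono)
    ultimately show ?thesis by simp
  qed
  have AP: "A \<subseteq> P" and eA: "\<And>x. x \<in> P \<Longrightarrow> e x \<in> A \<longleftrightarrow> x \<notin> A" using A by (auto simp: link_sets_def)
  have BP: "B \<subseteq> P" and vB: "\<And>x. x \<in> P \<Longrightarrow> v x \<in> B \<longleftrightarrow> x \<notin> B" using B by (auto simp: link_sets_def)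
  have "finite A" "finite B" "card A = card B"
    using AP BP fin finite_subset half[OF e A] half[OF v B] by auto
  then obtain f where f: "bij_betw f A B" using finite_same_card_bij by blast
  define g where "g = inv_into A f"
  have fg: "f a \<in> B" "g (f a) = a" if "a \<in> A" for a
    using f that unfolding g_def by (auto simp: bij_betw_def)
  have gf: "g b \<in> A" "f (g b) = b" if "b \<in> B" for b
    using f that unfolding g_def by (auto simp: bij_betw_def inv_into_into f_inv_into_f)
  define p where "p = (\<lambda>x. if x \<in> A then f x else if x \<in> P then v (f (e x)) else x)"
  have "p permutes P"
  proof (rule bij_imp_permutes)
    show "bij_betw p P P"
      by (rule bij_betw_byWitness[where f' = "\<lambda>x. if x \<in> B then g x else e (g (v x))"])
        (use fg gf e v eA vB AP BP in \<open>auto simp: p_def subset_iff\<close>)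
  qed (use AP in \<open>auto simp: p_def\<close>)
  moreover have "p (e x) = v (p x)" for x
    using eA[of x] e v AP matching_fix[OF e, of x] matching_fix[OF v, of x]
    by (cases "x \<in> P") (auto simp: p_def)
  moreover have "p ` A = B" using f by (simp add: p_def bij_betw_def cong: image_cong)
  ultimately show ?thesis by blast
qed

text \<open>A signed form of \<open>(-2) ^ N\<close> that is multiplicative over the links.\<close>
lemma sum_transversals:
  assumes e: "matching e P" and v: "matching v P" and fin: "finite P"
    and p: "p permutes P" and conj: "\<And>x. p (e x) = v (p x)"
    and A: "A \<in> link_sets False e P" and B: "B \<in> link_sets False v P" and pA: "p ` A = B"
    and N: "card (link_sets True e P \<inter> link_sets True v P) = 2 ^ N"
  shows "(-2) ^ N = sign p * (-1) ^ (card P div 2) *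
     (\<Sum>X\<in>link_sets False e P \<inter> link_sets False v P. (-1) ^ (card (A \<inter> X) + card (B \<inter> X)))"
proof -
  obtain M where M: "card (link_sets True e P \<inter> link_sets True v P) = 2 ^ M"
    "(\<Sum>X\<in>link_sets False e P \<inter> link_sets False v P. sign (turn e v X)) = (-1) ^ (card P div 2) * (-2) ^ M"
    using sum_sign_turn[OF fin e v] by blast
  have "M = N" using M(1) N by simp
  moreover have "(\<Sum>X\<in>link_sets False e P \<inter> link_sets False v P. sign (turn e v X))
      = sign p * (\<Sum>X\<in>link_sets False e P \<inter> link_sets False v P. (-1) ^ (card (A \<inter> X) + card (B \<inter> X)))"
    unfolding sum_distrib_left by (intro sum.cong refl sign_conjugator[OF e v fin p conj A B pA])
  ultimately have *: "sign p * (\<Sum>X\<in>link_sets False e P \<inter> link_sets False v P. (-1) ^ (card (A \<inter> X) + card (B \<inter> X)))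
     = (-1) ^ (card P div 2) * (-2) ^ N"
    using M(2) by simp
  have "(-2) ^ N = ((-1) ^ (card P div 2) * (-1) ^ (card P div 2)) * ((-2 :: int) ^ N)"
    by (simp add: power_mult_distrib [symmetric])
  also have "\<dots> = (-1) ^ (card P div 2) * (sign p * (\<Sum>X\<in>link_sets False e P \<inter> link_sets False v P. (-1) ^ (card (A \<inter> X) + card (B \<inter> X))))"
    unfolding * by (simp add: mult_ac)
  finally show ?thesis by (simp add: mult_ac)
qed

text \<open>Closed sets are the unions of classes. This ties the number of components, a cardinality
  of a quotient, to the exponent N in \<open>sum_sign_turn\<close>, which is known only through the
  number of unions of curves.\<close>

lemma card_closed_sets:
  assumes Q: "Q \<subseteq> P \<times> P" "sym Q" and fin: "finite P"
  shows "card {S. S \<subseteq> P \<and> (\<forall>(x, y)\<in>Q. x \<in> S \<longrightarrow> y \<in> S)} = 2 ^ card (P // Q\<^sup>*)"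
proof -
  have eq: "equiv UNIV (Q\<^sup>*)" using Q(2) by (simp add: equiv_def refl_rtrancl sym_rtrancl trans_rtrancl)
  have stay: "y \<in> S" if "(x, y) \<in> Q\<^sup>*" "x \<in> S" "\<forall>(x, y)\<in>Q. x \<in> S \<longrightarrow> y \<in> S" for x y S
    using that by (induction rule: rtrancl_induct) auto
  have PQ: "\<forall>(x, y)\<in>Q. x \<in> P \<longrightarrow> y \<in> P" using Q(1) by auto
  have cls: "C = Q\<^sup>* `` {x}" if C: "C \<in> P // Q\<^sup>*" "x \<in> C" for C x
  proof -
    obtain z where z: "C = Q\<^sup>* `` {z}" using C(1) by (auto elim: quotientE)
    then have "(z, x) \<in> Q\<^sup>*" using C(2) by blast
    then show ?thesis unfolding z by (rule equiv_class_eq[OF eq])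
  qed
  have "bij_betw \<Union> (Pow (P // Q\<^sup>*)) {S. S \<subseteq> P \<and> (\<forall>(x, y)\<in>Q. x \<in> S \<longrightarrow> y \<in> S)}"
  proof (rule bij_betw_byWitness[where f' = "\<lambda>S. {C \<in> P // Q\<^sup>*. C \<subseteq> S}"])
    show "\<forall>F\<in>Pow (P // Q\<^sup>*). {C \<in> P // Q\<^sup>*. C \<subseteq> \<Union> F} = F"
    proof
      fix F assume F: "F \<in> Pow (P // Q\<^sup>*)"
      have "C \<in> F" if C: "C \<in> P // Q\<^sup>*" "C \<subseteq> \<Union> F" for C
      proof -
        obtain x where x: "C = Q\<^sup>* `` {x}" using C(1) by (auto elim: quotientE)
        then have "x \<in> C" by auto
        then obtain D where D: "D \<in> F" "x \<in> D" using C(2) by blast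
        then have "D = C" using cls[of D x] F x by blast
        then show ?thesis using D by simp
      qed
      then show "{C \<in> P // Q\<^sup>*. C \<subseteq> \<Union> F} = F" using F by blast
    qed
    show "\<forall>S\<in>{S. S \<subseteq> P \<and> (\<forall>(x, y)\<in>Q. x \<in> S \<longrightarrow> y \<in> S)}. \<Union> {C \<in> P // Q\<^sup>*. C \<subseteq> S} = S"
    proof clarify
      fix S assume S: "S \<subseteq> P" "\<forall>(x, y)\<in>Q. x \<in> S \<longrightarrow> y \<in> S"
      have "x \<in> \<Union> {C \<in> P // Q\<^sup>*. C \<subseteq> S}" if "x \<in> S" for x
      proof -
        have "Q\<^sup>* `` {x} \<in> P // Q\<^sup>*" using that S(1) by (auto simp: quotient_def)
        moreover have "Q\<^sup>* `` {x} \<subseteq> S" using stay[OF _ that S(2)] by blast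
        ultimately show ?thesis by blast
      qed
      then show "\<Union> {C \<in> P // Q\<^sup>*. C \<subseteq> S} = S" by blast
    qed
    show "\<Union> ` Pow (P // Q\<^sup>*) \<subseteq> {S. S \<subseteq> P \<and> (\<forall>(x, y)\<in>Q. x \<in> S \<longrightarrow> y \<in> S)}"
    proof clarify
      fix F assume F: "F \<subseteq> P // Q\<^sup>*"
      have "C \<subseteq> P" if "C \<in> F" for C
      proof -
        obtain x where "x \<in> P" "C = Q\<^sup>* `` {x}" using F \<open>C \<in> F\<close> by (auto elim: quotientE)
        then show ?thesis using stay[OF _ _ PQ] by auto
      qed
      moreover have "y \<in> C" if "C \<in> F" "x \<in> C" "(x, y) \<in> Q" for C x y
      proof -
        have "C = Q\<^sup>* `` {x}" using cls[of C x] F that by blast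
        then show ?thesis using that(3) by auto
      qed
      ultimately show "\<Union> F \<subseteq> P \<and> (\<forall>(x, y)\<in>Q. x \<in> \<Union> F \<longrightarrow> y \<in> \<Union> F)" by blast
    qed
  qed blast
  moreover have "finite (P // Q\<^sup>*)" using fin by (simp add: quotient_def)
  ultimately show ?thesis by (simp add: bij_betw_same_card [symmetric] card_Pow)
qed

section \<open>Counting permutations and parametrizing transversals\<close>

lemma card_permutes_stabilizer:
  assumes "finite S" "I \<subseteq> S"
  shows "card {p. p permutes S \<and> (\<forall>i\<in>S. p i \<in> I \<longleftrightarrow> i \<in> I)} = fact (card I) * fact (card S - card I)"
proof -
  have bij: "bij_betw (\<lambda>(a, b). a \<circ> b) ({a. a permutes I} \<times> {b. b permutes (S - I)})
      {p. p permutes S \<and> (\<forall>i\<in>S. p i \<in> I \<longleftrightarrow> i \<in> I)}"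
  proof (rule bij_betw_byWitness[where f' = "\<lambda>p. (\<lambda>x. if x \<in> I then p x else x, \<lambda>x. if x \<in> S - I then p x else x)"])
    have ab: "(a \<circ> b) x = (if x \<in> I then a x else b x)" "a x \<in> I \<longleftrightarrow> x \<in> I" "b x \<in> S - I \<longleftrightarrow> x \<in> S - I"
       if "a permutes I" "b permutes (S - I)" for a b x
    proof -
      show "a x \<in> I \<longleftrightarrow> x \<in> I" using permutes_in_image[OF that(1)] .
      show "b x \<in> S - I \<longleftrightarrow> x \<in> S - I" using permutes_in_image[OF that(2)] .
      show "(a \<circ> b) x = (if x \<in> I then a x else b x)"
        using permutes_not_in[OF that(1)] permutes_not_in[OF that(2)] permutes_in_image[OF that(2), of x]
        by (cases "x \<in> I"; cases "x \<in> S") auto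
    qed
    show "(\<lambda>(a, b). a \<circ> b) ` ({a. a permutes I} \<times> {b. b permutes S - I})
        \<subseteq> {p. p permutes S \<and> (\<forall>i\<in>S. p i \<in> I \<longleftrightarrow> i \<in> I)}"
    proof clarify
      fix a b assume *: "a permutes I" "b permutes S - I"
      have "a \<circ> b permutes S"
        using permutes_compose[OF permutes_subset[OF *(2)] permutes_subset[OF *(1)], of S] assms(2) by blast
      moreover have "(a \<circ> b) i \<in> I \<longleftrightarrow> i \<in> I" if "i \<in> S" for i
        using ab[OF *, of i] that by auto
      ultimately show "a \<circ> b permutes S \<and> (\<forall>i\<in>S. (a \<circ> b) i \<in> I \<longleftrightarrow> i \<in> I)" by blast
    qed
    show "(\<lambda>p. (\<lambda>x. if x \<in> I then p x else x, \<lambda>x. if x \<in> S - I then p x else x)) `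
        {p. p permutes S \<and> (\<forall>i\<in>S. p i \<in> I \<longleftrightarrow> i \<in> I)} \<subseteq> {a. a permutes I} \<times> {b. b permutes S - I}"
    proof (rule image_subsetI)
      fix p assume "p \<in> {p. p permutes S \<and> (\<forall>i\<in>S. p i \<in> I \<longleftrightarrow> i \<in> I)}"
      then have p: "p permutes S" "\<forall>i\<in>S. p i \<in> I \<longleftrightarrow> i \<in> I" by auto
      have restr: "(\<lambda>x. if x \<in> J then p x else x) permutes J"
        if J: "J \<subseteq> S" "\<And>x. x \<in> S \<Longrightarrow> p x \<in> J \<longleftrightarrow> x \<in> J" for J
      proof (rule bij_imp_permutes)
        have "p ` J \<subseteq> J" using J by blast
        moreover have "finite J" using J(1) assms(1) finite_subset by blast
        moreover have "inj_on p J" using permutes_inj[OF p(1)] by (metis inj_on_subset subset_UNIV)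
        ultimately have "bij_betw p J J" by (simp add: bij_betw_def endo_inj_surj)
        then show "bij_betw (\<lambda>x. if x \<in> J then p x else x) J J"
          by (rule bij_betw_cong[THEN iffD1, rotated]) simp
      qed simp
      show "(\<lambda>x. if x \<in> I then p x else x, \<lambda>x. if x \<in> S - I then p x else x) \<in> {a. a permutes I} \<times> {b. b permutes S - I}"
        using restr[of I] restr[of "S - I"] assms(2) p permutes_in_image[OF p(1)] by auto
    qed
    show "\<forall>c\<in>{a. a permutes I} \<times> {b. b permutes S - I}.
       (\<lambda>p. (\<lambda>x. if x \<in> I then p x else x, \<lambda>x. if x \<in> S - I then p x else x)) ((\<lambda>(a, b). a \<circ> b) c) = c"
    proof clarify
      fix a b assume *: "a permutes I" "b permutes S - I"
      show "(\<lambda>x. if x \<in> I then (a \<circ> b) x else x) = a \<and> (\<lambda>x. if x \<in> S - I then (a \<circ> b) x else x) = b"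
        using ab(1)[OF *] permutes_not_in[OF *(1)] permutes_not_in[OF *(2)] by (auto simp: fun_eq_iff simp del: comp_apply)
    qed
    show "\<forall>p\<in>{p. p permutes S \<and> (\<forall>i\<in>S. p i \<in> I \<longleftrightarrow> i \<in> I)}.
       (\<lambda>(a, b). a \<circ> b) (\<lambda>x. if x \<in> I then p x else x, \<lambda>x. if x \<in> S - I then p x else x) = p"
      using assms(2) by (auto simp: fun_eq_iff permutes_not_in subset_iff)
  qed
  have "finite I" using assms finite_subset by blast
  then show ?thesis
    using bij_betw_same_card[OF bij] assms
    by (simp add: card_cartesian_product card_permutations card_Diff_subset)
qed

text \<open>The permutations carrying \<open>I\<close> onto \<open>J\<close> form a coset of the
  stabilizer of \<open>I\<close>. This is the origin of the edge weights k! (n - k)!.\<close>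

lemma card_permutes_mapping:
  assumes fin: "finite S" and I: "I \<subseteq> S" and J: "J \<subseteq> S"
  shows "card {p. p permutes S \<and> (\<forall>i\<in>S. p i \<in> J \<longleftrightarrow> i \<in> I)}
     = (if card I = card J then fact (card I) * fact (card S - card I) else 0)"
proof (cases "card I = card J")
  case True
  have finI: "finite I" "finite J" using assms finite_subset by blast+
  obtain f g where f: "bij_betw f I J" and g: "bij_betw g (S - I) (S - J)"
    using finite_same_card_bij[OF finI True] finite_same_card_bij[of "S - I" "S - J"] fin True finI I J
    by (auto simp: card_Diff_subset)
  define r where "r = (\<lambda>x. if x \<in> I then f x else if x \<in> S then g x else x)"
  have rI: "bij_betw r I J" using f by (rule bij_betw_cong[THEN iffD1, rotated]) (simp add: r_def)
  have rS: "bij_betw r (S - I) (S - J)" using g by (rule bij_betw_cong[THEN iffD1, rotated]) (simp add: r_def)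
  have "bij_betw r (I \<union> (S - I)) (J \<union> (S - J))" by (rule bij_betw_combine[OF rI rS]) blast
  moreover have "I \<union> (S - I) = S" "J \<union> (S - J) = S" using I J by auto
  ultimately have r: "r permutes S" using I by (intro bij_imp_permutes) (auto simp: r_def)
  have rJ: "r i \<in> J \<longleftrightarrow> i \<in> I" if "i \<in> S" for i
    using rI rS that by (auto simp: bij_betw_def)
  have "bij_betw (\<lambda>p. r \<circ> p) {p. p permutes S \<and> (\<forall>i\<in>S. p i \<in> I \<longleftrightarrow> i \<in> I)}
     {p. p permutes S \<and> (\<forall>i\<in>S. p i \<in> J \<longleftrightarrow> i \<in> I)}"
  proof (rule bij_betw_byWitness[where f' = "\<lambda>p. inv r \<circ> p"])
    have ri: "r (inv r x) = x" "inv r (r x) = x" for x using permutes_inverses[OF r] by auto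
    have iS: "inv r x \<in> S \<longleftrightarrow> x \<in> S" for x using permutes_in_image[OF permutes_inv[OF r]] .
    have iJ: "inv r x \<in> I \<longleftrightarrow> x \<in> J" if "x \<in> S" for x using rJ[of "inv r x"] iS that ri by simp
    show "\<forall>a\<in>{p. p permutes S \<and> (\<forall>i\<in>S. p i \<in> I \<longleftrightarrow> i \<in> I)}. inv r \<circ> (r \<circ> a) = a"
      "\<forall>a\<in>{p. p permutes S \<and> (\<forall>i\<in>S. p i \<in> J \<longleftrightarrow> i \<in> I)}. r \<circ> (inv r \<circ> a) = a"
      using ri by (auto simp: fun_eq_iff)
    show "(\<circ>) r ` {p. p permutes S \<and> (\<forall>i\<in>S. p i \<in> I \<longleftrightarrow> i \<in> I)} \<subseteq> {p. p permutes S \<and> (\<forall>i\<in>S. p i \<in> J \<longleftrightarrow> i \<in> I)}"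
    proof (rule image_subsetI)
      fix p assume "p \<in> {p. p permutes S \<and> (\<forall>i\<in>S. p i \<in> I \<longleftrightarrow> i \<in> I)}"
      then have p: "p permutes S" "\<And>i. i \<in> S \<Longrightarrow> p i \<in> I \<longleftrightarrow> i \<in> I" by auto
      have "r (p i) \<in> J \<longleftrightarrow> i \<in> I" if "i \<in> S" for i
        using rJ[of "p i"] p(2)[OF that] permutes_in_image[OF p(1)] that by blast
      then show "r \<circ> p \<in> {p. p permutes S \<and> (\<forall>i\<in>S. p i \<in> J \<longleftrightarrow> i \<in> I)}"
        using permutes_compose[OF p(1) r] by simp
    qed
    show "(\<circ>) (inv r) ` {p. p permutes S \<and> (\<forall>i\<in>S. p i \<in> J \<longleftrightarrow> i \<in> I)} \<subseteq> {p. p permutes S \<and> (\<forall>i\<in>S. p i \<in> I \<longleftrightarrow> i \<in> I)}"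
    proof (rule image_subsetI)
      fix p assume "p \<in> {p. p permutes S \<and> (\<forall>i\<in>S. p i \<in> J \<longleftrightarrow> i \<in> I)}"
      then have p: "p permutes S" "\<And>i. i \<in> S \<Longrightarrow> p i \<in> J \<longleftrightarrow> i \<in> I" by auto
      have "inv r (p i) \<in> I \<longleftrightarrow> i \<in> I" if "i \<in> S" for i
        using iJ[of "p i"] p(2)[OF that] permutes_in_image[OF p(1)] that by blast
      then show "inv r \<circ> p \<in> {p. p permutes S \<and> (\<forall>i\<in>S. p i \<in> I \<longleftrightarrow> i \<in> I)}"
        using permutes_compose[OF p(1) permutes_inv[OF r]] by simp
    qed
  qed
  from bij_betw_same_card[OF this] show ?thesis
    using card_permutes_stabilizer[OF fin I] True by simp
next
  case False
  have "\<not> (p permutes S \<and> (\<forall>i\<in>S. p i \<in> J \<longleftrightarrow> i \<in> I))" for p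
  proof
    assume p: "p permutes S \<and> (\<forall>i\<in>S. p i \<in> J \<longleftrightarrow> i \<in> I)"
    then have inj: "inj p" and S: "p ` S = S" by (auto simp: permutes_inj permutes_image)
    have "p ` I = J"
    proof
      show "p ` I \<subseteq> J" using p I by blast
      show "J \<subseteq> p ` I"
      proof
        fix j assume j: "j \<in> J"
        then obtain i where "i \<in> S" "j = p i" using S J by blast
        then show "j \<in> p ` I" using p j by blast
      qed
    qed
    then have "card J = card I" using inj by (metis card_image inj_on_subset subset_UNIV)
    then show False using False by simp
  qed
  then have "{p. p permutes S \<and> (\<forall>i\<in>S. p i \<in> J \<longleftrightarrow> i \<in> I)} = {}" by blast
  then show ?thesis using False by (simp only: card.empty if_False)
qed

text \<open>Links are listed once, from their starting points; the condition is symmetric in the two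
  ends, so it then holds at every point.\<close>

lemma transversal_closed:
  assumes e: "matching e P" and A: "A \<in> link_sets False e P"
  shows "(\<forall>x\<in>A. e x \<in> S \<longleftrightarrow> x \<in> S) \<longleftrightarrow> (\<forall>x\<in>P. e x \<in> S \<longleftrightarrow> x \<in> S)"
proof
  assume *: "\<forall>x\<in>A. e x \<in> S \<longleftrightarrow> x \<in> S"
  show "\<forall>x\<in>P. e x \<in> S \<longleftrightarrow> x \<in> S"
  proof
    fix x assume x: "x \<in> P"
    then have "x \<in> A \<or> e x \<in> A" using A unfolding link_sets_def by blast
    then show "e x \<in> S \<longleftrightarrow> x \<in> S" using * matching_invol[OF e, of x] by metis
  qed
next
  assume *: "\<forall>x\<in>P. e x \<in> S \<longleftrightarrow> x \<in> S"
  have "A \<subseteq> P" using A by (simp add: link_sets_def)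
  with * show "\<forall>x\<in>A. e x \<in> S \<longleftrightarrow> x \<in> S" by blast
qed

lemma matching_conj:
  assumes m: "matching m P" and p: "p permutes P"
  shows "matching (p \<circ> m \<circ> inv p) P"
proof -
  have i: "p (inv p x) = x" "inv p (p x) = x" for x using permutes_inverses[OF p] by auto
  have "p (m (inv p x)) = x \<longleftrightarrow> x \<notin> P" for x
    using i m permutes_in_image[OF permutes_inv[OF p], of x]
    by (metis matching_def)
  then show ?thesis using i m by (simp add: matching_def)
qed

section \<open>Spin networks\<close>

lemma prod_of_bool:
  "finite A \<Longrightarrow> (\<Prod>a\<in>A. of_bool (P a)) = (of_bool (\<forall>a\<in>A. P a) :: 'b::comm_semiring_1)"
  by (induction A rule: finite_induct) auto

lemma sum_reflect:
  "(\<Sum>k\<le>n. f (if b then k else n - k)) = (\<Sum>k\<le>(n::nat). f k)"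
proof (cases b)
  case False
  have "(\<Sum>k\<le>n. f (n - k)) = (\<Sum>k\<le>n. f k)"
    by (rule sum.reindex_bij_witness[where i = "\<lambda>k. n - k" and j = "\<lambda>k. n - k"]) auto
  with False show ?thesis by simp
qed simp

lemma transversal_link_sets:
  assumes m: "matching m P" and A: "A \<in> link_sets False m P" and X: "X \<subseteq> P"
  shows "X \<in> link_sets False m P \<longleftrightarrow> (\<forall>x\<in>A. m x \<in> X \<longleftrightarrow> x \<notin> X)"
proof
  assume *: "\<forall>x\<in>A. m x \<in> X \<longleftrightarrow> x \<notin> X"
  have "m x \<in> X \<longleftrightarrow> x \<notin> X" if x: "x \<in> P" for x
  proof -
    have "x \<in> A \<or> m x \<in> A" using A x unfolding link_sets_def by blast
    then show ?thesis using * matching_invol[OF m, of x] by metis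
  qed
  then show "X \<in> link_sets False m P" using X by (simp add: link_sets_def)
next
  assume "X \<in> link_sets False m P"
  moreover have "A \<subseteq> P" using A by (simp add: link_sets_def)
  ultimately show "\<forall>x\<in>A. m x \<in> X \<longleftrightarrow> x \<notin> X" unfolding link_sets_def by blast
qed

text \<open>The selection is free on the reference points \<open>A\<close> and forced on their
  partners.\<close>

lemma bij_betw_transversal:
  assumes m: "matching m P" and A: "A \<in> link_sets False m P"
  shows "bij_betw (\<lambda>X. A \<inter> X) (link_sets False m P) (Pow A)"
proof (rule bij_betw_byWitness[where f' = "\<lambda>S. S \<union> m ` (A - S)"])
  have AP: "A \<subseteq> P" and mA: "\<And>x. x \<in> P \<Longrightarrow> m x \<in> A \<longleftrightarrow> x \<notin> A" using A by (simp_all add: link_sets_def)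
  have inv: "m (m x) = x" for x using m by simp
  show "\<forall>X\<in>link_sets False m P. A \<inter> X \<union> m ` (A - A \<inter> X) = X"
  proof
    fix X assume "X \<in> link_sets False m P"
    then have XP: "X \<subseteq> P" and mX: "\<And>x. x \<in> P \<Longrightarrow> m x \<in> X \<longleftrightarrow> x \<notin> X" by (simp_all add: link_sets_def)
    have "x \<in> A \<inter> X \<union> m ` (A - A \<inter> X)" if "x \<in> X" for x
    proof (cases "x \<in> A")
      case False
      then have "m x \<in> A - A \<inter> X" using mA mX that XP by blast
      then have "m (m x) \<in> m ` (A - A \<inter> X)" by (rule imageI)
      then show ?thesis by (simp only: inv Un_iff simp_thms)
    qed (use that in blast)
    moreover have "m x \<in> X" if "x \<in> A - A \<inter> X" for x
      using that mX AP by blast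
    ultimately show "A \<inter> X \<union> m ` (A - A \<inter> X) = X"
      by (intro subset_antisym Un_least Int_lower2 image_subsetI subsetI)
  qed
  have mm: "m x \<notin> A" if "x \<in> A" for x using that mA AP by blast
  show "\<forall>S\<in>Pow A. A \<inter> (S \<union> m ` (A - S)) = S"
  proof
    fix S assume "S \<in> Pow A"
    moreover have "A \<inter> m ` (A - S) = {}" using mm by blast
    ultimately show "A \<inter> (S \<union> m ` (A - S)) = S" unfolding Int_Un_distrib by (simp add: Int_absorb1)
  qed
  show "(\<lambda>S. S \<union> m ` (A - S)) ` Pow A \<subseteq> link_sets False m P"
  proof (rule image_subsetI)
    fix S assume S: "S \<in> Pow A"
    have "m ` (A - S) \<subseteq> P" using AP m by (intro image_subsetI) auto
    then have "S \<union> m ` (A - S) \<subseteq> P" using S AP by simp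
    moreover have "m x \<in> S \<union> m ` (A - S) \<longleftrightarrow> x \<notin> S \<union> m ` (A - S)" if x: "x \<in> A" for x
    proof -
      have "m x \<notin> S" using mm[OF x] S by (metis PowD subsetD)
      moreover have "x \<notin> m ` (A - S)" using mm x by (metis DiffD1 imageE)
      moreover have "m x \<in> m ` (A - S) \<longleftrightarrow> x \<in> A - S"
        by (rule inj_image_mem_iff[OF permutes_inj[OF matching_permutes[OF m]]])
      ultimately show ?thesis using x by simp
    qed
    ultimately show "S \<union> m ` (A - S) \<in> link_sets False m P"
      using transversal_link_sets[OF m A] by blast
  qed
qed blast

text \<open>The set is written as \<open>{e3, e2, e1}\<close> because \<open>sum_PiE_insert\<close>
  makes the inserted element the innermost sum. The constant \<open>undefined\<close> is the only
  function on the empty domain.\<close>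

lemma L2_set_PiE_triple:
  fixes f :: "('e \<Rightarrow> nat) \<Rightarrow> real"
  assumes "e1 \<noteq> e2" "e1 \<noteq> e3" "e2 \<noteq> e3"
  shows "(L2_set f (PiE {e3, e2, e1} D))\<^sup>2
    = (\<Sum>a\<in>D e1. \<Sum>b\<in>D e2. \<Sum>c\<in>D e3. (f ((\<lambda>_. undefined)(e1 := a, e2 := b, e3 := c)))\<^sup>2)"
  using assms by (simp add: L2_set_def sum_nonneg sum_PiE_insert) (simp add: fun_upd_def)

text \<open>The triangle inequalities keep the natural-number subtractions from truncating, and
  parity makes the halves exact.\<close>

lemma half_sums:
  fixes a b c :: nat
  assumes "even (a + b + c)" "c \<le> a + b" "\<bar>int a - int b\<bar> \<le> int c"
  shows "a = (a + b - c) div 2 + (c + a - b) div 2"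
proof -
  obtain k where k: "a + b + c = 2 * k" using assms(1) by (rule evenE)
  have "a + b - c = 2 * (k - c)" "c + a - b = 2 * (k - b)" "c \<le> k" "b \<le> k" using k assms by auto
  then show ?thesis using k by simp
qed

locale spin_network =
  fixes \<rho> :: "'e::finite hedge \<Rightarrow> 'e hedge" and \<gamma> :: "'e \<Rightarrow> nat"
  assumes ribbon: "cubic_ribbon \<rho>" and no_loops: "no_loops \<rho>" and adm: "admissible \<rho> \<gamma>"
begin

section \<open>The strand diagram as a pair of matchings\<close>

abbreviation deg :: "'e hedge \<Rightarrow> nat" where "deg h \<equiv> \<gamma> (fst h)"
abbreviation xn :: "'e hedge \<Rightarrow> nat" where "xn \<equiv> xnext \<rho> \<gamma>"
abbreviation pts :: "('e hedge \<times> nat) set" where "pts \<equiv> spoints \<gamma>"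

text \<open>The second branch follows a vertex link backwards, \<open>\<rho> (\<rho> h)\<close>
  being the predecessor of \<open>h\<close>. Fixing everything outside \<open>pts\<close> makes this
  an involution of the whole type.\<close>

definition vlink :: "'e hedge \<times> nat \<Rightarrow> 'e hedge \<times> nat" where
  "vlink = (\<lambda>(h, i). if i < deg h then
      if deg h - xn h \<le> i then (\<rho> h, deg h - 1 - i) else (\<rho> (\<rho> h), deg (\<rho> (\<rho> h)) - 1 - i)
     else (h, i))"

text \<open>These are the edge links of the identity state.\<close>

definition flip :: "'e hedge \<times> nat \<Rightarrow> 'e hedge \<times> nat" where
  "flip = (\<lambda>((e, b), i). if i < \<gamma> e then ((e, \<not> b), \<gamma> e - 1 - i) else ((e, b), i))"

text \<open>Only the \<open>False\<close> ends move, in reversed positions, so that conjugating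
  \<open>flip\<close> yields precisely the links of \<open>edge_links\<close>. The set
  \<open>F\<close> is there for an induction over edges that computes the sign.\<close>

definition shuffle :: "'e set \<Rightarrow> ('e \<Rightarrow> nat \<Rightarrow> nat) \<Rightarrow> 'e hedge \<times> nat \<Rightarrow> 'e hedge \<times> nat" where
  "shuffle F \<sigma> = (\<lambda>((e, b), i). if e \<in> F \<and> \<not> b \<and> i < \<gamma> e then ((e, b), \<gamma> e - 1 - \<sigma> e (\<gamma> e - 1 - i)) else ((e, b), i))"

text \<open>Inserting \<open>\<sigma>\<close> is written as a conjugation, so that \<open>\<sigma>\<close> changes the permutation that carries
  edge links to vertex links exactly by the factor \<^const>\<open>shuffle\<close>.\<close>
definition elink :: "('e \<Rightarrow> nat \<Rightarrow> nat) \<Rightarrow> 'e hedge \<times> nat \<Rightarrow> 'e hedge \<times> nat" where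
  "elink \<sigma> = shuffle UNIV \<sigma> \<circ> flip \<circ> inv (shuffle UNIV \<sigma>)"

text \<open>\<open>tails\<close> and \<open>starts\<close> consist of the first components of
  \<open>edge_links\<close> and \<open>vertex_links\<close>; they serve as the reference
  transversals for all states.\<close>

definition tails :: "('e hedge \<times> nat) set" where
  "tails = {p \<in> pts. snd (fst p)}"

definition strands :: "'e hedge \<Rightarrow> ('e hedge \<times> nat) set" where
  "strands h = {h} \<times> {deg h - xn h..<deg h}"

definition starts :: "('e hedge \<times> nat) set" where
  "starts = (\<Union>h. strands h)"

lemma \<rho>3 [simp]: "\<rho> (\<rho> (\<rho> h)) = h"
  using ribbon unfolding cubic_ribbon_def by blast

lemma \<rho>_neq: "\<rho> h \<noteq> h" "\<rho> (\<rho> h) \<noteq> h" "\<rho> (\<rho> h) \<noteq> \<rho> h"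
  using ribbon by (metis cubic_ribbon_def)+

text \<open>A strand at \<open>h\<close> goes on to the next half-edge or back to the previous one;
  the latter kind is counted at the predecessor.\<close>

lemma deg_eq: "deg h = xn h + xn (\<rho> (\<rho> h))"
proof -
  have "even (deg h + deg (\<rho> h) + deg (\<rho> (\<rho> h)))" "deg (\<rho> (\<rho> h)) \<le> deg h + deg (\<rho> h)"
    "\<bar>int (deg h) - int (deg (\<rho> h))\<bar> \<le> int (deg (\<rho> (\<rho> h)))"
    using adm unfolding admissible_def Let_def by blast+
  then show ?thesis unfolding xnext_def \<rho>3 by (rule half_sums)
qed

lemma deg_\<rho>_eq: "deg (\<rho> h) = xn h + xn (\<rho> h)" "deg (\<rho> (\<rho> h)) = xn (\<rho> h) + xn (\<rho> (\<rho> h))"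
  using deg_eq[of "\<rho> h"] deg_eq[of "\<rho> (\<rho> h)"] by simp_all

lemma finite_pts: "finite pts"
proof (rule finite_subset)
  show "pts \<subseteq> (SIGMA h:UNIV. {..<deg h})" by (auto simp: spoints_def)
qed auto

lemma in_pts [simp]: "(h, i) \<in> pts \<longleftrightarrow> i < deg h"
  by (simp add: spoints_def)

lemma vlink_start: "i < deg h \<Longrightarrow> deg h - xn h \<le> i \<Longrightarrow> vlink (h, i) = (\<rho> h, deg h - 1 - i)"
  by (simp add: vlink_def)

lemma vlink_end: "i < xn h \<Longrightarrow> vlink (\<rho> h, i) = (h, deg h - 1 - i)"
proof -
  assume i: "i < xn h"
  have "i < deg (\<rho> h)" "\<not> deg (\<rho> h) - xn (\<rho> h) \<le> i" using i deg_\<rho>_eq(1)[of h] by linarith+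
  then show ?thesis unfolding vlink_def prod.case by (simp only: if_True if_False \<rho>3)
qed

lemma matching_vlink: "matching vlink pts"
proof -
  have "vlink (vlink p) = p \<and> (vlink p \<noteq> p \<longleftrightarrow> p \<in> pts)" for p
  proof (cases p)
    case (Pair h i)
    consider "\<not> i < deg h" | "i < deg h" "deg h - xn h \<le> i" | "i < deg h" "\<not> deg h - xn h \<le> i" by blast
    then show ?thesis
    proof cases
      case 1
      then show ?thesis by (simp add: Pair vlink_def)
    next
      case 2
      have "deg h - 1 - i < xn h" "deg h - 1 - (deg h - 1 - i) = i" using 2 by arith+
      then have "vlink (\<rho> h, deg h - 1 - i) = (h, i)" using vlink_end[of "deg h - 1 - i" h] by simp
      moreover have "vlink (h, i) = (\<rho> h, deg h - 1 - i)" using 2 by (rule vlink_start)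
      ultimately show ?thesis
        using 2(1) \<rho>_neq(1)[of h] in_pts[of h i] unfolding Pair by (metis fst_conv)
    next
      case 3
      define g where "g = \<rho> (\<rho> h)"
      have g: "\<rho> (\<rho> h) = g" and h: "h = \<rho> g" by (simp_all add: g_def)
      have i: "i < xn g" using 3 deg_eq[of h] unfolding g by linarith
      have gi: "xn g \<le> deg g" using deg_eq[of g] by linarith
      have *: "deg g - 1 - (deg g - 1 - i) = i" "deg g - 1 - i < deg g" "deg g - xn g \<le> deg g - 1 - i"
        using i gi by arith+
      have "vlink (\<rho> g, i) = (g, deg g - 1 - i)" using i by (rule vlink_end)
      moreover have "vlink (g, deg g - 1 - i) = (\<rho> g, i)" using vlink_start[OF *(2,3)] unfolding *(1) .
      ultimately show ?thesis
        using 3(1) \<rho>_neq(1)[of g] in_pts[of h i] unfolding Pair h by (metis fst_conv)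
    qed
  qed
  then show ?thesis unfolding matching_def by blast
qed

lemma matching_flip: "matching flip pts"
  by (auto simp: matching_def flip_def split: if_splits)

lemma states_permutes: "\<sigma> \<in> states \<gamma> \<Longrightarrow> \<sigma> e permutes {..<\<gamma> e}"
  by (simp add: states_def)

lemma states_less: "\<sigma> \<in> states \<gamma> \<Longrightarrow> \<sigma> e i < \<gamma> e \<longleftrightarrow> i < \<gamma> e"
  using permutes_in_image[OF states_permutes, of \<sigma> e i] by simp

text \<open>One edge contributes a copy of \<open>\<sigma> e\<close> transported along an injection
  into the points, and such a copy has the same sign.\<close>

lemma shuffle_insert:
  assumes "e \<notin> F" "\<sigma> \<in> states \<gamma>"
  shows "shuffle (insert e F) \<sigma>
    = map_permutation {..<\<gamma> e} (\<lambda>i. ((e, False), \<gamma> e - 1 - i)) (\<sigma> e) \<circ> shuffle F \<sigma>" (is "_ = ?m \<circ> _")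
    and "inj_on (\<lambda>i. ((e, False), \<gamma> e - 1 - i)) {..<\<gamma> e}"
    and "map_permutation {..<\<gamma> e} (\<lambda>i. ((e, False), \<gamma> e - 1 - i)) (\<sigma> e) permutes pts"
proof -
  let ?f = "\<lambda>i. ((e, False), \<gamma> e - 1 - i)"
  show inj: "inj_on ?f {..<\<gamma> e}" by (auto simp: inj_on_def)
  have "?m permutes ?f ` {..<\<gamma> e}"
    using inj states_permutes[OF assms(2)] by (intro map_permutation_permutes) (simp_all add: bij_betw_def)
  then have perm: "?m permutes ?f ` {..<\<gamma> e}" .
  then show "?m permutes pts" by (rule permutes_subset) auto
  define M where "M = ?m"
  have m: "M ((e', b), i) = (if e' = e \<and> \<not> b \<and> i < \<gamma> e then ((e, False), \<gamma> e - 1 - \<sigma> e (\<gamma> e - 1 - i)) else ((e', b), i))" for e' b i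
  proof (cases "e' = e \<and> \<not> b \<and> i < \<gamma> e")
    case True
    then have "((e', b), i) = ?f (\<gamma> e - 1 - i)" by simp
    moreover have "M (?f (\<gamma> e - 1 - i)) = ?f (\<sigma> e (\<gamma> e - 1 - i))"
      unfolding M_def by (rule map_permutation_apply[OF inj]) (use True in auto)
    ultimately show ?thesis using True by simp
  next
    case False
    then have "((e', b), i) \<notin> ?f ` {..<\<gamma> e}" by auto
    then have "M ((e', b), i) = ((e', b), i)" by (rule permutes_not_in[OF perm[folded M_def]])
    then show ?thesis by (simp only: if_not_P[OF False])
  qed
  show "shuffle (insert e F) \<sigma> = ?m \<circ> shuffle F \<sigma>"
    unfolding M_def [symmetric]
  proof
    fix p :: "'e hedge \<times> nat"
    obtain h i where "p = (h, i)" by (rule prod.exhaust)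
    moreover obtain e' b where "h = (e', b)" by (rule prod.exhaust)
    ultimately have p: "p = ((e', b), i)" by simp
    show "shuffle (insert e F) \<sigma> p = (M \<circ> shuffle F \<sigma>) p"
      using assms(1) by (auto simp: p shuffle_def m)
  qed
qed

lemma shuffle_permutes_sign:
  assumes "\<sigma> \<in> states \<gamma>" "finite F"
  shows "shuffle F \<sigma> permutes pts \<and> sign (shuffle F \<sigma>) = (\<Prod>e\<in>F. sign (\<sigma> e))"
  using assms(2)
proof (induction F rule: finite_induct)
  case empty
  have "shuffle {} \<sigma> = id" by (auto simp: shuffle_def)
  then show ?case using permutes_id[of pts] by (simp only: prod.empty sign_id)
next
  case (insert e F)
  note s = shuffle_insert[OF insert.hyps(2) assms(1)]
  have "permutation (map_permutation {..<\<gamma> e} (\<lambda>i. ((e, False), \<gamma> e - 1 - i)) (\<sigma> e))" "permutation (shuffle F \<sigma>)"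
    using s(3) insert.IH finite_pts permutation_permutes by blast+
  moreover have "sign (map_permutation {..<\<gamma> e} (\<lambda>i. ((e, False), \<gamma> e - 1 - i)) (\<sigma> e)) = sign (\<sigma> e)"
    by (rule sign_map_permutation[OF s(2) states_permutes[OF assms(1)]]) simp
  moreover have "shuffle (insert e F) \<sigma> permutes pts"
    unfolding s(1) using insert.IH s(3) by (blast intro: permutes_compose)
  moreover from calculation(1,2) have "sign (shuffle (insert e F) \<sigma>)
      = sign (map_permutation {..<\<gamma> e} (\<lambda>i. ((e, False), \<gamma> e - 1 - i)) (\<sigma> e)) * sign (shuffle F \<sigma>)"
    unfolding s(1) by (rule sign_compose)
  ultimately show ?case using insert.hyps insert.IH by (simp only: prod.insert simp_thms)
qed

lemmas shuffle_permutes = shuffle_permutes_sign[THEN conjunct1, OF _ finite_UNIV]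
lemmas sign_shuffle = shuffle_permutes_sign[THEN conjunct2, OF _ finite_UNIV]

lemma inv_shuffle_tail: "\<sigma> \<in> states \<gamma> \<Longrightarrow> inv (shuffle UNIV \<sigma>) ((e, True), i) = ((e, True), i)"
proof -
  assume \<sigma>: "\<sigma> \<in> states \<gamma>"
  have "shuffle UNIV \<sigma> ((e, True), i) = ((e, True), i)" by (simp add: shuffle_def)
  then show ?thesis using permutes_inverses(2)[OF shuffle_permutes[OF \<sigma>]] by metis
qed

lemma matching_elink: "\<sigma> \<in> states \<gamma> \<Longrightarrow> matching (elink \<sigma>) pts"
  unfolding elink_def by (rule matching_conj[OF matching_flip shuffle_permutes])

lemma elink_tail:
  "\<sigma> \<in> states \<gamma> \<Longrightarrow> i < \<gamma> e \<Longrightarrow> elink \<sigma> ((e, True), i) = ((e, False), \<gamma> e - 1 - \<sigma> e i)"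
  by (simp add: elink_def inv_shuffle_tail) (simp add: flip_def shuffle_def)

lemma elink_swaps:
  assumes \<sigma>: "\<sigma> \<in> states \<gamma>" and "p \<in> pts"
  shows "snd (fst (elink \<sigma> p)) \<longleftrightarrow> \<not> snd (fst p)"
proof -
  have s: "snd (fst (shuffle UNIV \<sigma> q)) = snd (fst q)" for q by (auto simp: shuffle_def split: prod.splits)
  have "snd (fst (inv (shuffle UNIV \<sigma>) p)) = snd (fst p)"
    using s[of "inv (shuffle UNIV \<sigma>) p"] permutes_inverses(1)[OF shuffle_permutes[OF \<sigma>]] by simp
  moreover have "inv (shuffle UNIV \<sigma>) p \<in> pts"
    using permutes_in_image[OF permutes_inv[OF shuffle_permutes[OF \<sigma>]]] assms(2) by blast
  moreover have "snd (fst (flip q)) \<longleftrightarrow> \<not> snd (fst q)" if "q \<in> pts" for q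
    using that by (cases q) (auto simp: flip_def)
  ultimately show ?thesis by (simp add: elink_def s)
qed

lemma tails_link_sets: "\<sigma> \<in> states \<gamma> \<Longrightarrow> tails \<in> link_sets False (elink \<sigma>) pts"
  using elink_swaps matching_elink by (auto simp: tails_def link_sets_def)

lemma tails_link_sets_flip: "tails \<in> link_sets False flip pts"
  using matching_flip by (auto simp: tails_def link_sets_def flip_def)

lemma in_starts: "(h, i) \<in> starts \<longleftrightarrow> i < deg h \<and> deg h - xn h \<le> i"
  by (auto simp: starts_def strands_def)

lemma starts_link_sets: "starts \<in> link_sets False vlink pts"
proof -
  have "vlink (h, i) \<in> starts \<longleftrightarrow> (h, i) \<notin> starts" if "i < deg h" for h i
    using that deg_eq[of h] deg_\<rho>_eq[of h] by (auto simp: in_starts vlink_def)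
  moreover have "starts \<subseteq> pts" by (auto simp: in_starts)
  ultimately show ?thesis by (auto simp: link_sets_def)
qed

lemma edge_links_eq:
  assumes "\<sigma> \<in> states \<gamma>"
  shows "edge_links \<gamma> \<sigma> = (\<lambda>p. (p, elink \<sigma> p)) ` tails"
proof -
  have "tails = (\<lambda>(e, i). ((e, True), i)) ` {(e, i). i < \<gamma> e}"
    by (force simp: tails_def)
  moreover have "edge_links \<gamma> \<sigma> = (\<lambda>(e, i). (((e, True), i), ((e, False), \<gamma> e - 1 - \<sigma> e i))) ` {(e, i). i < \<gamma> e}"
    by (force simp: edge_links_def)
  ultimately show ?thesis
    by (simp only: image_image) (rule image_cong, auto simp: elink_tail[OF assms])
qed

lemma vertex_links_eq: "vertex_links \<rho> \<gamma> = (\<lambda>p. (p, vlink p)) ` starts"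
proof -
  have "starts = {(h, i). i < deg h \<and> deg h - xn h \<le> i}"
    by (auto simp: in_starts)
  moreover have "vertex_links \<rho> \<gamma> = (\<lambda>(h, i). ((h, i), (\<rho> h, deg h - 1 - i))) ` {(h, i). i < deg h \<and> deg h - xn h \<le> i}"
    by (force simp: vertex_links_def)
  ultimately show ?thesis
    by (simp only:) (rule image_cong, auto simp: vlink_start)
qed

text \<open>Sets closed under the symmetrized links are exactly the sets invariant under both
  matchings, so \<open>card_closed_sets\<close> applies.\<close>

lemma ncurves_eq:
  assumes \<sigma>: "\<sigma> \<in> states \<gamma>"
  shows "card (link_sets True (elink \<sigma>) pts \<inter> link_sets True vlink pts) = 2 ^ ncurves \<rho> \<gamma> \<sigma>"
proof -
  define R where "R = edge_links \<gamma> \<sigma> \<union> vertex_links \<rho> \<gamma>"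
  note E = edge_links_eq[OF \<sigma>] and V = vertex_links_eq
  have sub: "tails \<subseteq> pts" "starts \<subseteq> pts"
    using tails_link_sets[OF \<sigma>] starts_link_sets by (simp_all add: link_sets_def)
  have Q: "R \<union> R\<inverse> \<subseteq> pts \<times> pts" "sym (R \<union> R\<inverse>)"
    using sub matching_elink[OF \<sigma>] matching_vlink by (auto simp: R_def E V sym_Un_converse)
  have "(\<forall>(x, y)\<in>R \<union> R\<inverse>. x \<in> S \<longrightarrow> y \<in> S) \<longleftrightarrow>
      (\<forall>x\<in>pts. elink \<sigma> x \<in> S \<longleftrightarrow> x \<in> S) \<and> (\<forall>x\<in>pts. vlink x \<in> S \<longleftrightarrow> x \<in> S)" for S
  proof -
    have "(\<forall>(x, y)\<in>R \<union> R\<inverse>. x \<in> S \<longrightarrow> y \<in> S) \<longleftrightarrow> (\<forall>(x, y)\<in>R. y \<in> S \<longleftrightarrow> x \<in> S)" by blast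
    also have "\<dots> \<longleftrightarrow> (\<forall>x\<in>tails. elink \<sigma> x \<in> S \<longleftrightarrow> x \<in> S) \<and> (\<forall>x\<in>starts. vlink x \<in> S \<longleftrightarrow> x \<in> S)"
      unfolding R_def E V by (simp only: ball_Un ball_simps prod.case)
    finally show ?thesis
      unfolding transversal_closed[OF matching_elink[OF \<sigma>] tails_link_sets[OF \<sigma>]]
        transversal_closed[OF matching_vlink starts_link_sets] .
  qed
  then have "{S. S \<subseteq> pts \<and> (\<forall>(x, y)\<in>R \<union> R\<inverse>. x \<in> S \<longrightarrow> y \<in> S)}
      = link_sets True (elink \<sigma>) pts \<inter> link_sets True vlink pts"
    by (auto simp only: link_sets_def simp_thms)
  then show ?thesis
    using card_closed_sets[OF Q finite_pts] by (simp add: ncurves_def R_def Let_def)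
qed

lemma state_weight:
  obtains c :: int where "\<bar>c\<bar> = 1"
    "\<And>\<sigma>. \<sigma> \<in> states \<gamma> \<Longrightarrow> (\<Prod>e\<in>UNIV. sign (\<sigma> e)) * (-2) ^ ncurves \<rho> \<gamma> \<sigma>
       = c * (\<Sum>X\<in>link_sets False (elink \<sigma>) pts \<inter> link_sets False vlink pts.
            (-1) ^ (card (tails \<inter> X) + card (starts \<inter> X)))"
proof -
  obtain p where p: "p permutes pts" "\<And>x. p (flip x) = vlink (p x)" "p ` tails = starts"
    using ex_conjugator[OF matching_flip matching_vlink finite_pts tails_link_sets_flip starts_link_sets] by blast
  show ?thesis
  proof
    show "\<bar>sign p * (-1) ^ (card pts div 2)\<bar> = 1" by (simp add: abs_mult power_abs sign_def)
    fix \<sigma> assume \<sigma>: "\<sigma> \<in> states \<gamma>"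
    let ?s = "shuffle UNIV \<sigma>"
    \<comment> \<open>\<open>p\<close> conjugates the identity state into the vertex links, hence
      \<open>q\<close> does so for \<open>\<sigma>\<close>. Its sign contains that of the state
      once, so multiplying by the state's sign leaves \<open>sign p\<close>.\<close>
    define q where "q = p \<circ> inv ?s"
    note s = shuffle_permutes[OF \<sigma>]
    have q: "q permutes pts" unfolding q_def by (rule permutes_compose[OF permutes_inv[OF s] p(1)])
    have conj: "q (elink \<sigma> x) = vlink (q x)" for x
      using p(2) permutes_inverses[OF s] by (simp add: q_def elink_def)
    \<comment> \<open>The shuffle does not touch \<open>True\<close> ends, so the same reference
      transversals work for every state.\<close>
    have "inv ?s ` tails = tails"
      using inv_shuffle_tail[OF \<sigma>] by (force simp: tails_def image_iff)
    then have qA: "q ` tails = starts" unfolding q_def using p(3) by (metis image_comp)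
    have "permutation p" "permutation ?s" "permutation (inv ?s)"
      using p(1) s permutes_inv[OF s] finite_pts permutation_permutes by blast+
    then have "sign q = sign p * (\<Prod>e\<in>UNIV. sign (\<sigma> e))"
      unfolding q_def by (simp add: sign_compose sign_inverse sign_shuffle[OF \<sigma>])
    moreover have "(\<Prod>e\<in>UNIV. sign (\<sigma> e)) * (\<Prod>e\<in>UNIV. sign (\<sigma> e)) = 1"
      by (simp add: prod.distrib [symmetric])
    ultimately have "(\<Prod>e\<in>UNIV. sign (\<sigma> e)) * sign q = sign p" by (simp add: mult.left_commute)
    then show "(\<Prod>e\<in>UNIV. sign (\<sigma> e)) * (-2) ^ ncurves \<rho> \<gamma> \<sigma>
       = sign p * (-1) ^ (card pts div 2) * (\<Sum>X\<in>link_sets False (elink \<sigma>) pts \<inter> link_sets False vlink pts.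
            (-1) ^ (card (tails \<inter> X) + card (starts \<inter> X)))"
      using sum_transversals[OF matching_elink[OF \<sigma>] matching_vlink finite_pts q conj
          tails_link_sets[OF \<sigma>] starts_link_sets qA ncurves_eq[OF \<sigma>]]
      by (simp add: mult.assoc [symmetric])
  qed
qed

section \<open>Summing over states and separating the vertices\<close>

definition cnt :: "('e hedge \<times> nat) set \<Rightarrow> 'e hedge \<Rightarrow> nat" where
  "cnt X h = card {i. (h, i) \<in> X}"

text \<open>An edge joins an end carrying \<open>k\<close> selected points to an end carrying \<open>\<gamma> e - k\<close> of them.\<close>
definition occ :: "('e \<Rightarrow> nat) \<Rightarrow> 'e hedge \<Rightarrow> nat" where
  "occ \<kappa> h = (if snd h then \<kappa> (fst h) else \<gamma> (fst h) - \<kappa> (fst h))"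

definition vert :: "'e hedge \<Rightarrow> 'e hedge set" where
  "vert h = {h, \<rho> h, \<rho> (\<rho> h)}"

lemma finite_states: "finite (states \<gamma>)"
proof -
  have "states \<gamma> = PiE UNIV (\<lambda>e. {p. p permutes {..<\<gamma> e}})"
    by (auto simp: states_def PiE_UNIV_domain)
  then show ?thesis by (simp add: finite_PiE finite_permutations)
qed

lemma cnt_le: "X \<subseteq> pts \<Longrightarrow> cnt X h \<le> deg h"
proof -
  assume "X \<subseteq> pts"
  then have "{i. (h, i) \<in> X} \<subseteq> {..<deg h}" by (auto simp: spoints_def)
  then have "card {i. (h, i) \<in> X} \<le> card {..<deg h}" by (intro card_mono) auto
  then show ?thesis by (simp add: cnt_def)
qed

text \<open>The edges are independent: \<open>\<sigma> e\<close> must carry the unselected tail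
  positions \<open>I e\<close> onto the positions \<open>J e\<close> whose opposite points are
  selected, since each link has exactly one selected end.\<close>

lemma card_compatible_states:
  assumes X: "X \<subseteq> pts"
  shows "card {\<sigma> \<in> states \<gamma>. X \<in> link_sets False (elink \<sigma>) pts}
    = (\<Prod>e\<in>UNIV. if \<gamma> e - cnt X (e, True) = cnt X (e, False)
         then fact (cnt X (e, True)) * fact (\<gamma> e - cnt X (e, True)) else 0)"
proof -
  define I where "I e = {i \<in> {..<\<gamma> e}. ((e, True), i) \<notin> X}" for e
  define J where "J e = {j \<in> {..<\<gamma> e}. ((e, False), \<gamma> e - 1 - j) \<in> X}" for e
  define W where "W e = {p. p permutes {..<\<gamma> e} \<and> (\<forall>i\<in>{..<\<gamma> e}. p i \<in> J e \<longleftrightarrow> i \<in> I e)}" for e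
  have iff: "X \<in> link_sets False (elink \<sigma>) pts \<longleftrightarrow> (\<forall>e. \<forall>i\<in>{..<\<gamma> e}. \<sigma> e i \<in> J e \<longleftrightarrow> i \<in> I e)"
    if \<sigma>: "\<sigma> \<in> states \<gamma>" for \<sigma>
  proof -
    have "X \<in> link_sets False (elink \<sigma>) pts \<longleftrightarrow> (\<forall>x\<in>tails. elink \<sigma> x \<in> X \<longleftrightarrow> x \<notin> X)"
      by (rule transversal_link_sets[OF matching_elink[OF \<sigma>] tails_link_sets[OF \<sigma>] X])
    also have "\<dots> \<longleftrightarrow> (\<forall>e. \<forall>i\<in>{..<\<gamma> e}. elink \<sigma> ((e, True), i) \<in> X \<longleftrightarrow> ((e, True), i) \<notin> X)"
      by (auto simp: tails_def)
    also have "\<dots> \<longleftrightarrow> (\<forall>e. \<forall>i\<in>{..<\<gamma> e}. \<sigma> e i \<in> J e \<longleftrightarrow> i \<in> I e)"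
      using states_less[OF \<sigma>] by (simp add: elink_tail[OF \<sigma>] I_def J_def)
    finally show ?thesis .
  qed
  have "(\<forall>e. \<sigma> e \<in> W e) \<longleftrightarrow> \<sigma> \<in> states \<gamma> \<and> (\<forall>e. \<forall>i\<in>{..<\<gamma> e}. \<sigma> e i \<in> J e \<longleftrightarrow> i \<in> I e)" for \<sigma>
    unfolding W_def states_def by blast
  then have "{\<sigma> \<in> states \<gamma>. X \<in> link_sets False (elink \<sigma>) pts} = PiE UNIV W"
    unfolding PiE_UNIV_domain Pi_def using iff by blast
  then have "card {\<sigma> \<in> states \<gamma>. X \<in> link_sets False (elink \<sigma>) pts} = (\<Prod>e\<in>UNIV. card (W e))"
    by (simp add: card_PiE)
  moreover have "card (W e) = (if \<gamma> e - cnt X (e, True) = cnt X (e, False)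
         then fact (cnt X (e, True)) * fact (\<gamma> e - cnt X (e, True)) else 0)" for e
  proof -
    have sub: "{i. ((e, b), i) \<in> X} \<subseteq> {..<\<gamma> e}" for b using X by (auto simp: spoints_def)
    have "I e = {..<\<gamma> e} - {i. ((e, True), i) \<in> X}" by (auto simp: I_def)
    then have cI: "card (I e) = \<gamma> e - cnt X (e, True)"
      using sub[of True] by (simp add: cnt_def card_Diff_subset finite_subset)
    have "bij_betw (\<lambda>j. \<gamma> e - 1 - j) (J e) {i. ((e, False), i) \<in> X}"
      by (rule bij_betw_byWitness[where f' = "\<lambda>j. \<gamma> e - 1 - j"]) (use sub[of False] in \<open>auto simp: J_def\<close>)
    then have cJ: "card (J e) = cnt X (e, False)" unfolding cnt_def by (rule bij_betw_same_card)
    have "card (W e) = (if card (I e) = card (J e) then fact (card (I e)) * fact (card {..<\<gamma> e} - card (I e)) else 0)"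
      unfolding W_def by (rule card_permutes_mapping) (auto simp: I_def J_def)
    moreover have "card {..<\<gamma> e} - card (I e) = cnt X (e, True)"
      using cnt_le[OF X, of "(e, True)"] by (simp add: cI)
    ultimately show ?thesis by (simp only: cI cJ mult.commute)
  qed
  ultimately show ?thesis by simp
qed

lemma card_tails_Int: "X \<subseteq> pts \<Longrightarrow> card (tails \<inter> X) = (\<Sum>e\<in>UNIV. cnt X (e, True))"
proof -
  assume X: "X \<subseteq> pts"
  have "finite {i. ((e, True), i) \<in> X}" for e
  proof (rule finite_subset)
    show "{i. ((e, True), i) \<in> X} \<subseteq> {..<\<gamma> e}" using X by (auto simp: spoints_def)
  qed simp
  then have "card (SIGMA e:UNIV. {i. ((e, True), i) \<in> X}) = (\<Sum>e\<in>UNIV. cnt X (e, True))"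
    by (simp add: cnt_def)
  moreover have "tails \<inter> X = (\<lambda>(e, i). ((e, True), i)) ` (SIGMA e:UNIV. {i. ((e, True), i) \<in> X})"
    using X by (force simp: tails_def)
  ultimately show ?thesis by (simp add: card_image inj_on_def case_prod_unfold)
qed

text \<open>The sign from \<open>tails\<close> is absorbed into the edge weights as (-1)^k; the sign
  from \<open>starts\<close> is kept for the vertices.\<close>

lemma penrose_eval_link_sets:
  obtains c :: real where "\<bar>c\<bar> = 1"
    "penrose_eval \<rho> \<gamma> = c * (\<Sum>X\<in>link_sets False vlink pts. (-1) ^ card (starts \<inter> X) *
       (\<Prod>e\<in>UNIV. if \<gamma> e - cnt X (e, True) = cnt X (e, False)
         then (-1) ^ cnt X (e, True) * fact (cnt X (e, True)) * fact (\<gamma> e - cnt X (e, True)) else 0))"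
proof -
  obtain c :: int where c: "\<bar>c\<bar> = 1"
    "\<And>\<sigma>. \<sigma> \<in> states \<gamma> \<Longrightarrow> (\<Prod>e\<in>UNIV. sign (\<sigma> e)) * (-2) ^ ncurves \<rho> \<gamma> \<sigma>
       = c * (\<Sum>X\<in>link_sets False (elink \<sigma>) pts \<inter> link_sets False vlink pts.
            (-1) ^ (card (tails \<inter> X) + card (starts \<inter> X)))"
    using state_weight by blast
  let ?L = "link_sets False vlink pts"
  have finL: "finite ?L"
    by (rule finite_subset[of _ "Pow pts"]) (auto simp: link_sets_def finite_pts)
  have "(\<Sum>\<sigma>\<in>states \<gamma>. (\<Prod>e\<in>UNIV. sign (\<sigma> e)) * (-2) ^ ncurves \<rho> \<gamma> \<sigma>)
     = (\<Sum>\<sigma>\<in>states \<gamma>. c * (\<Sum>X\<in>{X \<in> ?L. X \<in> link_sets False (elink \<sigma>) pts}. (-1) ^ (card (tails \<inter> X) + card (starts \<inter> X))))"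
  proof (rule sum.cong[OF refl])
    fix \<sigma> assume \<sigma>: "\<sigma> \<in> states \<gamma>"
    have "link_sets False (elink \<sigma>) pts \<inter> ?L = {X \<in> ?L. X \<in> link_sets False (elink \<sigma>) pts}" by blast
    then show "(\<Prod>e\<in>UNIV. sign (\<sigma> e)) * (-2) ^ ncurves \<rho> \<gamma> \<sigma>
      = c * (\<Sum>X\<in>{X \<in> ?L. X \<in> link_sets False (elink \<sigma>) pts}. (-1) ^ (card (tails \<inter> X) + card (starts \<inter> X)))"
      using c(2)[OF \<sigma>] by simp
  qed
  also have "\<dots> = c * (\<Sum>\<sigma>\<in>states \<gamma>. \<Sum>X\<in>{X \<in> ?L. X \<in> link_sets False (elink \<sigma>) pts}. (-1) ^ (card (tails \<inter> X) + card (starts \<inter> X)))"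
    by (rule sum_distrib_left [symmetric])
  also have "\<dots> = c * (\<Sum>X\<in>?L. \<Sum>\<sigma>\<in>{\<sigma> \<in> states \<gamma>. X \<in> link_sets False (elink \<sigma>) pts}. (-1) ^ (card (tails \<inter> X) + card (starts \<inter> X)))"
    by (subst sum.swap_restrict[OF finite_states finL]) simp
  finally have Z: "(\<Sum>\<sigma>\<in>states \<gamma>. (\<Prod>e\<in>UNIV. sign (\<sigma> e)) * (-2) ^ ncurves \<rho> \<gamma> \<sigma>)
     = c * (\<Sum>X\<in>?L. int (card {\<sigma> \<in> states \<gamma>. X \<in> link_sets False (elink \<sigma>) pts}) * (-1) ^ (card (tails \<inter> X) + card (starts \<inter> X)))"
    by simp
  show ?thesis
  proof
    show "\<bar>real_of_int c\<bar> = 1" using c(1) by linarith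
    have "penrose_eval \<rho> \<gamma> = real_of_int (\<Sum>\<sigma>\<in>states \<gamma>. (\<Prod>e\<in>UNIV. sign (\<sigma> e)) * (-2) ^ ncurves \<rho> \<gamma> \<sigma>)"
      by (simp add: penrose_eval_def)
    also have "\<dots> = real_of_int c * (\<Sum>X\<in>?L. (-1) ^ card (starts \<inter> X) *
       (real (card {\<sigma> \<in> states \<gamma>. X \<in> link_sets False (elink \<sigma>) pts}) * (-1) ^ card (tails \<inter> X)))"
      unfolding Z by (simp add: power_add mult_ac)
    also have "\<dots> = real_of_int c * (\<Sum>X\<in>?L. (-1) ^ card (starts \<inter> X) *
       (\<Prod>e\<in>UNIV. if \<gamma> e - cnt X (e, True) = cnt X (e, False)
         then (-1) ^ cnt X (e, True) * fact (cnt X (e, True)) * fact (\<gamma> e - cnt X (e, True)) else 0))"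
    proof -
      have "real (card {\<sigma> \<in> states \<gamma>. X \<in> link_sets False (elink \<sigma>) pts}) * (-1) ^ card (tails \<inter> X)
        = (\<Prod>e\<in>UNIV. if \<gamma> e - cnt X (e, True) = cnt X (e, False)
         then (-1) ^ cnt X (e, True) * fact (cnt X (e, True)) * fact (\<gamma> e - cnt X (e, True)) else 0)"
        if "X \<in> ?L" for X
      proof -
        have X: "X \<subseteq> pts" using that by (simp add: link_sets_def)
        show ?thesis
          unfolding card_compatible_states[OF X] card_tails_Int[OF X] power_sum of_nat_prod prod.distrib [symmetric]
          by (intro prod.cong) auto
      qed
      then show ?thesis by simp
    qed
    finally show "penrose_eval \<rho> \<gamma> = real_of_int c * (\<Sum>X\<in>?L. (-1) ^ card (starts \<inter> X) *
       (\<Prod>e\<in>UNIV. if \<gamma> e - cnt X (e, True) = cnt X (e, False)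
         then (-1) ^ cnt X (e, True) * fact (cnt X (e, True)) * fact (\<gamma> e - cnt X (e, True)) else 0))" .
  qed
qed

lemma occ_all: "(\<forall>h. cnt X h = occ \<kappa> h) \<longleftrightarrow> (\<forall>e. cnt X (e, True) = \<kappa> e \<and> cnt X (e, False) = \<gamma> e - \<kappa> e)"
  unfolding split_paired_All all_bool_eq occ_def by auto

text \<open>Only the label \<open>\<kappa> e = cnt X (e, True)\<close> can contribute. Introducing
  labels turns the coupling of the two ends of an edge into separate conditions at half-edges, after
  which the sum over \<open>X\<close> splits into vertices.\<close>

lemma edge_weights_expand:
  assumes X: "X \<subseteq> pts"
  shows "(\<Prod>e\<in>UNIV. if \<gamma> e - cnt X (e, True) = cnt X (e, False)
         then (-1) ^ cnt X (e, True) * fact (cnt X (e, True)) * fact (\<gamma> e - cnt X (e, True)) else 0)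
    = (\<Sum>\<kappa>\<in>PiE UNIV (\<lambda>e. {..\<gamma> e}). of_bool (\<forall>h. cnt X h = occ \<kappa> h) *
         (\<Prod>e\<in>UNIV. (-1) ^ \<kappa> e * fact (\<kappa> e) * fact (\<gamma> e - \<kappa> e) :: real))"
proof -
  define w where "w e k = ((-1) ^ k * fact k * fact (\<gamma> e - k) :: real)" for e k
  have "(if \<gamma> e - cnt X (e, True) = cnt X (e, False) then w e (cnt X (e, True)) else 0)
      = (\<Sum>k\<le>\<gamma> e. of_bool (cnt X (e, True) = k \<and> cnt X (e, False) = \<gamma> e - k) * w e k)" for e
  proof -
    have "(\<Sum>k\<le>\<gamma> e. of_bool (cnt X (e, True) = k \<and> cnt X (e, False) = \<gamma> e - k) * w e k)
       = (\<Sum>k\<le>\<gamma> e. if k = cnt X (e, True) then (if \<gamma> e - cnt X (e, True) = cnt X (e, False) then w e (cnt X (e, True)) else 0) else 0)"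
      by (intro sum.cong) auto
    then show ?thesis using cnt_le[OF X, of "(e, True)"] by simp
  qed
  then have "(\<Prod>e\<in>UNIV. if \<gamma> e - cnt X (e, True) = cnt X (e, False) then w e (cnt X (e, True)) else 0)
     = (\<Prod>e\<in>UNIV. \<Sum>k\<le>\<gamma> e. of_bool (cnt X (e, True) = k \<and> cnt X (e, False) = \<gamma> e - k) * w e k)"
    by (intro prod.cong refl)
  also have "\<dots> = (\<Sum>\<kappa>\<in>PiE UNIV (\<lambda>e. {..\<gamma> e}). \<Prod>e\<in>UNIV. of_bool (cnt X (e, True) = \<kappa> e \<and> cnt X (e, False) = \<gamma> e - \<kappa> e) * w e (\<kappa> e))"
    by (rule prod_sum_PiE) simp_all
  finally show ?thesis unfolding w_def prod.distrib occ_all by (simp add: prod_of_bool)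
qed

text \<open>Points on \<open>h\<close> either start a strand towards the next half-edge or end one
  from the previous half-edge; an end is selected exactly when its start is not.\<close>

lemma cnt_eq:
  assumes X: "X \<in> link_sets False vlink pts"
  shows "cnt X h = card ((starts \<inter> X) \<inter> strands h) + card (strands (\<rho> (\<rho> h)) - (starts \<inter> X))"
proof -
  define g where "g = \<rho> (\<rho> h)"
  have h: "h = \<rho> g" by (simp add: g_def)
  have XP: "X \<subseteq> pts" and vX: "\<And>x. x \<in> pts \<Longrightarrow> vlink x \<in> X \<longleftrightarrow> x \<notin> X" using X by (simp_all add: link_sets_def)
  have sP: "strands k \<subseteq> pts" "strands k \<subseteq> starts" "finite (strands k)" for k
    by (auto simp: strands_def starts_def)
  have xg: "xn g \<le> deg g" using deg_eq[of g] by linarith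
  have eq: "Pair h ` {i. (h, i) \<in> X} = (X \<inter> strands h) \<union> vlink ` (strands g - X)"
  proof (intro set_eqI iffI)
    fix q assume "q \<in> Pair h ` {i. (h, i) \<in> X}"
    then obtain i where q: "q = (h, i)" and hi: "(h, i) \<in> X" by blast
    then have ih: "i < deg h" using XP by (auto simp: spoints_def)
    show "q \<in> (X \<inter> strands h) \<union> vlink ` (strands g - X)"
    proof (cases "deg h - xn h \<le> i")
      case True
      then show ?thesis using q hi ih by (simp add: strands_def)
    next
      case False
      then have i: "i < xn g" using deg_eq[of h] unfolding g_def by linarith
      then have vq: "vlink q = (g, deg g - 1 - i)" unfolding q h by (rule vlink_end)
      have "vlink q \<in> strands g" using i xg by (auto simp: vq strands_def)
      moreover have "vlink q \<notin> X" using vX[of q] hi XP q by blast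
      moreover have "vlink (vlink q) = q" using matching_vlink by simp
      ultimately show ?thesis by (metis DiffI UnI2 imageI)
    qed
  next
    fix q assume "q \<in> (X \<inter> strands h) \<union> vlink ` (strands g - X)"
    then show "q \<in> Pair h ` {i. (h, i) \<in> X}"
    proof
      assume "q \<in> vlink ` (strands g - X)"
      then obtain i where i: "deg g - xn g \<le> i" "i < deg g" "(g, i) \<notin> X" and q: "q = vlink (g, i)"
        by (auto simp: strands_def)
      have "q = (h, deg g - 1 - i)" unfolding q h by (rule vlink_start[OF i(2,1)])
      moreover have "q \<in> X" using vX[of "(g, i)"] i q by simp
      ultimately show ?thesis by blast
    qed (auto simp: strands_def)
  qed
  have disj: "(X \<inter> strands h) \<inter> vlink ` (strands g - X) = {}"
    using starts_link_sets sP unfolding link_sets_def by blast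
  have inj: "inj vlink" using matching_eq_iff[OF matching_vlink] by (auto simp: inj_def)
  have "cnt X h = card (Pair h ` {i. (h, i) \<in> X})"
    unfolding cnt_def by (rule card_image [symmetric]) (simp add: inj_on_def)
  also have "\<dots> = card (X \<inter> strands h) + card (vlink ` (strands g - X))"
    unfolding eq using disj sP(3) by (intro card_Un_disjoint) auto
  also have "card (vlink ` (strands g - X)) = card (strands g - X)"
    by (intro card_image inj_on_subset[OF inj] subset_UNIV)
  finally show ?thesis
    unfolding g_def [symmetric] using sP(2)[of h] sP(2)[of g]
    by (auto intro!: arg_cong2[where f = "(+)"] arg_cong[where f = card])
qed

lemma vert_eq: "g \<in> vert h \<Longrightarrow> vert g = vert h"
  unfolding vert_def using \<rho>3 by (elim insertE) auto

lemma rvertices_eq: "rvertices \<rho> = range vert"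
  by (simp add: rvertices_def vert_def)

lemma in_rvertices: "v \<in> rvertices \<rho> \<Longrightarrow> h \<in> v \<Longrightarrow> v = vert h"
  unfolding rvertices_eq using vert_eq by blast

lemma finite_rvertices: "finite (rvertices \<rho>)" "v \<in> rvertices \<rho> \<Longrightarrow> finite v"
  by (auto simp: rvertices_def)

lemma vert_self: "h \<in> vert h" by (simp add: vert_def)

text \<open>With \<open>UNIV\<close> in place of a vertex, the same formula is the summand of the
  whole diagram.\<close>

definition vsum :: "('e \<Rightarrow> nat) \<Rightarrow> 'e hedge set \<Rightarrow> ('e hedge \<times> nat) set \<Rightarrow> real" where
  "vsum \<kappa> v S = (-1) ^ card S *
     of_bool (\<forall>h\<in>v. card (S \<inter> strands h) + card (strands (\<rho> (\<rho> h)) - S) = occ \<kappa> h)"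

text \<open>\<open>X\<close> amounts to an arbitrary subset of \<open>starts\<close>, which is a
  disjoint union of blocks, one per vertex. The condition at \<open>h\<close> involves only strands
  of \<open>h\<close> and of its predecessor, hence a single block.\<close>

lemma sum_link_sets_factor:
  "(\<Sum>X\<in>link_sets False vlink pts. (-1) ^ card (starts \<inter> X) * of_bool (\<forall>h. cnt X h = occ \<kappa> h))
    = (\<Prod>v\<in>rvertices \<rho>. \<Sum>S\<in>Pow (\<Union>h\<in>v. strands h). vsum \<kappa> v S)"
proof -
  define B where "B v = (\<Union>h\<in>v. strands h)" for v
  have finB: "finite (B v)" if "v \<in> rvertices \<rho>" for v
    using finite_rvertices(2)[OF that] by (simp add: B_def strands_def)
  have disj: "disjoint_family_on B (rvertices \<rho>)"
  proof (unfold disjoint_family_on_def, intro ballI impI)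
    fix v w assume vw: "v \<in> rvertices \<rho>" "w \<in> rvertices \<rho>" "v \<noteq> w"
    then have "h \<noteq> g" if "h \<in> v" "g \<in> w" for h g using that in_rvertices by blast
    then show "B v \<inter> B w = {}" by (auto simp: B_def strands_def)
  qed
  have starts: "starts = (\<Union>v\<in>rvertices \<rho>. B v)"
    unfolding starts_def B_def rvertices_eq using vert_self by blast
  have finS: "finite starts" unfolding starts using finite_rvertices(1) finB by blast
  have "(\<Sum>X\<in>link_sets False vlink pts. (-1) ^ card (starts \<inter> X) * of_bool (\<forall>h. cnt X h = occ \<kappa> h))
      = (\<Sum>X\<in>link_sets False vlink pts. vsum \<kappa> UNIV (starts \<inter> X))"
    by (intro sum.cong) (auto simp: vsum_def cnt_eq)
  also have "\<dots> = (\<Sum>S\<in>Pow starts. vsum \<kappa> UNIV S)"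
    by (rule sum.reindex_bij_betw[OF bij_betw_transversal[OF matching_vlink starts_link_sets]])
  also have "\<dots> = (\<Sum>S\<in>Pow (\<Union>v\<in>rvertices \<rho>. B v). \<Prod>v\<in>rvertices \<rho>. vsum \<kappa> v (S \<inter> B v))"
  proof (rule sum.cong)
    show "Pow starts = Pow (\<Union>v\<in>rvertices \<rho>. B v)" by (simp add: starts)
    fix S assume "S \<in> Pow (\<Union>v\<in>rvertices \<rho>. B v)"
    then have S: "S \<subseteq> (\<Union>v\<in>rvertices \<rho>. B v)" by blast
    have "card (\<Union>v\<in>rvertices \<rho>. S \<inter> B v) = (\<Sum>v\<in>rvertices \<rho>. card (S \<inter> B v))"
    proof (rule card_UN_disjoint[OF finite_rvertices(1)])
      show "\<forall>v\<in>rvertices \<rho>. finite (S \<inter> B v)" using finB by blast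
      show "\<forall>v\<in>rvertices \<rho>. \<forall>w\<in>rvertices \<rho>. v \<noteq> w \<longrightarrow> S \<inter> B v \<inter> (S \<inter> B w) = {}"
        using disj unfolding disjoint_family_on_def by blast
    qed
    moreover have "(\<Union>v\<in>rvertices \<rho>. S \<inter> B v) = S" using S by blast
    ultimately have c: "card S = (\<Sum>v\<in>rvertices \<rho>. card (S \<inter> B v))" by simp
    have loc: "card (S \<inter> B v \<inter> strands h) + card (strands (\<rho> (\<rho> h)) - S \<inter> B v) = card (S \<inter> strands h) + card (strands (\<rho> (\<rho> h)) - S)"
      if "v \<in> rvertices \<rho>" "h \<in> v" for v h
    proof -
      have "\<rho> (\<rho> h) \<in> v" using in_rvertices[OF that] by (simp add: vert_def)
      then have "strands h \<subseteq> B v" "strands (\<rho> (\<rho> h)) \<subseteq> B v" using that by (auto simp: B_def)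
      then have "S \<inter> B v \<inter> strands h = S \<inter> strands h" "strands (\<rho> (\<rho> h)) - S \<inter> B v = strands (\<rho> (\<rho> h)) - S" by blast+
      then show ?thesis by simp
    qed
    have all: "(\<forall>h. Q h) \<longleftrightarrow> (\<forall>v\<in>rvertices \<rho>. \<forall>h\<in>v. Q h)" for Q
      unfolding rvertices_eq using vert_self by blast
    have "(\<Prod>v\<in>rvertices \<rho>. vsum \<kappa> v (S \<inter> B v))
      = (\<Prod>v\<in>rvertices \<rho>. (-1) ^ card (S \<inter> B v) * of_bool (\<forall>h\<in>v. card (S \<inter> strands h) + card (strands (\<rho> (\<rho> h)) - S) = occ \<kappa> h))"
      unfolding vsum_def by (intro prod.cong refl) (simp add: loc)
    also have "\<dots> = vsum \<kappa> UNIV S"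
      unfolding prod.distrib prod_of_bool[OF finite_rvertices(1)] all [symmetric]
      by (simp add: vsum_def c power_sum)
    finally show "vsum \<kappa> UNIV S = (\<Prod>v\<in>rvertices \<rho>. vsum \<kappa> v (S \<inter> B v))" by simp
  qed
  also have "\<dots> = (\<Prod>v\<in>rvertices \<rho>. \<Sum>S\<in>Pow (B v). vsum \<kappa> v S)"
    by (rule sum_Pow_Union[OF finite_rvertices(1) finB disj])
  finally show ?thesis by (simp add: B_def)
qed

section \<open>The contraction of vertex tensors and its bound\<close>

lemma penrose_eval_tensor:
  obtains c :: real where "\<bar>c\<bar> = 1"
    "penrose_eval \<rho> \<gamma> = c * (\<Sum>\<kappa>\<in>PiE UNIV (\<lambda>e. {..\<gamma> e}).
       (\<Prod>e\<in>UNIV. (-1) ^ \<kappa> e * fact (\<kappa> e) * fact (\<gamma> e - \<kappa> e)) *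
       (\<Prod>v\<in>rvertices \<rho>. \<Sum>S\<in>Pow (\<Union>h\<in>v. strands h). vsum \<kappa> v S))"
proof -
  let ?L = "link_sets False vlink pts"
  let ?K = "PiE UNIV (\<lambda>e. {..\<gamma> e})"
  let ?w = "\<lambda>\<kappa>. \<Prod>e\<in>UNIV. (-1) ^ \<kappa> e * fact (\<kappa> e) * fact (\<gamma> e - \<kappa> e) :: real"
  obtain c :: real where c: "\<bar>c\<bar> = 1"
    "penrose_eval \<rho> \<gamma> = c * (\<Sum>X\<in>?L. (-1) ^ card (starts \<inter> X) *
       (\<Prod>e\<in>UNIV. if \<gamma> e - cnt X (e, True) = cnt X (e, False)
         then (-1) ^ cnt X (e, True) * fact (cnt X (e, True)) * fact (\<gamma> e - cnt X (e, True)) else 0))"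
    by (rule penrose_eval_link_sets)
  have "(\<Sum>X\<in>?L. (-1) ^ card (starts \<inter> X) *
       (\<Prod>e\<in>UNIV. if \<gamma> e - cnt X (e, True) = cnt X (e, False)
         then (-1) ^ cnt X (e, True) * fact (cnt X (e, True)) * fact (\<gamma> e - cnt X (e, True)) else 0))
     = (\<Sum>X\<in>?L. \<Sum>\<kappa>\<in>?K. ?w \<kappa> * ((-1) ^ card (starts \<inter> X) * of_bool (\<forall>h. cnt X h = occ \<kappa> h)))"
  proof (rule sum.cong[OF refl])
    fix X assume "X \<in> ?L"
    then have X: "X \<subseteq> pts" by (simp add: link_sets_def)
    show "(-1) ^ card (starts \<inter> X) *
       (\<Prod>e\<in>UNIV. if \<gamma> e - cnt X (e, True) = cnt X (e, False)
         then (-1) ^ cnt X (e, True) * fact (cnt X (e, True)) * fact (\<gamma> e - cnt X (e, True)) else 0)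
     = (\<Sum>\<kappa>\<in>?K. ?w \<kappa> * ((-1) ^ card (starts \<inter> X) * of_bool (\<forall>h. cnt X h = occ \<kappa> h)))"
      unfolding edge_weights_expand[OF X] sum_distrib_left by (intro sum.cong refl) (simp only: mult_ac)
  qed
  also have "\<dots> = (\<Sum>\<kappa>\<in>?K. \<Sum>X\<in>?L. ?w \<kappa> * ((-1) ^ card (starts \<inter> X) * of_bool (\<forall>h. cnt X h = occ \<kappa> h)))"
    by (rule sum.swap)
  also have "\<dots> = (\<Sum>\<kappa>\<in>?K. ?w \<kappa> * (\<Prod>v\<in>rvertices \<rho>. \<Sum>S\<in>Pow (\<Union>h\<in>v. strands h). vsum \<kappa> v S))"
    unfolding sum_distrib_left [symmetric] sum_link_sets_factor ..
  finally show ?thesis using that c by simp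
qed

text \<open>Each end of an edge receives the square root of the edge weight. The absolute value
  discards the remaining signs and supplies the nonnegativity required by
  \<open>tensor_contraction_le\<close>.\<close>

definition tensor :: "'e hedge set \<Rightarrow> ('e \<Rightarrow> nat) \<Rightarrow> real" where
  "tensor v \<kappa> = \<bar>\<Sum>S\<in>Pow (\<Union>h\<in>v. strands h). vsum \<kappa> v S\<bar> *
     (\<Prod>h\<in>v. sqrt (fact (occ \<kappa> h) * fact (deg h - occ \<kappa> h)))"

text \<open>Two half-edges of one edge at a vertex would be a loop. Consequently the legs of a
  vertex tensor can be indexed by edges.\<close>

lemma vert_inj_fst: "inj_on fst (vert h)"
proof (rule inj_onI, rule ccontr)
  fix g g' assume g: "g \<in> vert h" "g' \<in> vert h" "fst g = fst g'" "g \<noteq> g'"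
  define e where "e = fst g"
  have "(e, True) \<in> {g, g'}" "(e, False) \<in> {g, g'}"
    using g(3,4) unfolding e_def by (cases g; cases g'; cases "snd g"; auto)+
  then have "(e, True) \<in> vert h" "(e, False) \<in> vert h" using g by blast+
  then have "(e, False) \<in> vert (e, True)" using vert_eq by blast
  then show False using no_loops unfolding no_loops_def vert_def by blast
qed

lemma fst_vert:
  "fst (\<rho> h) \<noteq> fst h" "fst (\<rho> (\<rho> h)) \<noteq> fst h" "fst (\<rho> (\<rho> h)) \<noteq> fst (\<rho> h)"
  using vert_inj_fst[of h] \<rho>_neq unfolding inj_on_def vert_def by blast+

lemma prod_vert: "(\<Prod>g\<in>vert h. f g) = f h * f (\<rho> h) * f (\<rho> (\<rho> h))"
proof -
  have "h \<notin> {\<rho> h, \<rho> (\<rho> h)}" "\<rho> h \<notin> {\<rho> (\<rho> h)}" using \<rho>_neq[of h] by auto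
  then show ?thesis unfolding vert_def by (simp add: mult.assoc)
qed

lemma sum_vert: "(\<Sum>g\<in>vert h. f g) = f h + f (\<rho> h) + f (\<rho> (\<rho> h))"
proof -
  have "h \<notin> {\<rho> h, \<rho> (\<rho> h)}" "\<rho> h \<notin> {\<rho> (\<rho> h)}" using \<rho>_neq[of h] by auto
  then show ?thesis unfolding vert_def by (simp add: add.assoc)
qed

text \<open>The strands leaving \<open>h\<close>, \<open>\<rho> h\<close> and
  \<open>\<rho> (\<rho> h)\<close> are the factors [12], [23] and [31], and the set of selected
  starting points is the choice of terms in \<open>vten_Pow\<close>.\<close>

lemma vsum_vten:
  "(\<Sum>S\<in>Pow (\<Union>g\<in>vert h. strands g). vsum \<kappa> (vert h) S)
    = vten (xn h) (xn (\<rho> h)) (xn (\<rho> (\<rho> h))) (int (occ \<kappa> h)) (int (occ \<kappa> (\<rho> h))) (int (occ \<kappa> (\<rho> (\<rho> h))))"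
proof -
  have card: "card (strands g) = xn g" for g
    using deg_eq[of g] by (simp add: strands_def card_cartesian_product)
  have disj: "strands h \<inter> strands (\<rho> h) = {}" "strands (\<rho> h) \<inter> strands (\<rho> (\<rho> h)) = {}" "strands h \<inter> strands (\<rho> (\<rho> h)) = {}"
    using \<rho>_neq[of h] by (auto simp: strands_def)
  have fin: "finite (strands g)" for g by (simp add: strands_def)
  have un: "(\<Union>g\<in>vert h. strands g) = strands h \<union> strands (\<rho> h) \<union> strands (\<rho> (\<rho> h))"
    by (auto simp: vert_def)
  show ?thesis
    unfolding un card [symmetric] vten_Pow[OF fin fin fin disj, symmetric]
    by (intro sum.cong refl) (auto simp: vsum_def vert_def)
qed

lemma L2_tensor:
  "L2_set (tensor (vert h)) (PiE (fst ` vert h) (\<lambda>e. {..\<gamma> e}))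
    = sqrt (fact (xn h + xn (\<rho> h) + xn (\<rho> (\<rho> h)) + 1) * fact (xn h) * fact (xn (\<rho> h)) * fact (xn (\<rho> (\<rho> h))))"
proof -
  define x y z where xyz: "x = xn h" "y = xn (\<rho> h)" "z = xn (\<rho> (\<rho> h))"
  have deg: "deg h = x + z" "deg (\<rho> h) = x + y" "deg (\<rho> (\<rho> h)) = y + z"
    unfolding xyz using deg_eq[of h] deg_\<rho>_eq[of h] by simp_all
  define G where "G a b c = (vten x y z (int a) (int b) (int c))\<^sup>2 *
      (fact a * fact (x + z - a)) * (fact b * fact (x + y - b)) * (fact c * fact (y + z - c))" for a b c :: nat
  \<comment> \<open>At a \<open>False\<close> end the label counts unselected points; the reflection
    k -> n - k permutes the summation range, so the norm does not depend on which ends meet the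
    vertex.\<close>
  define r where "r g k = (if snd g then k else deg g - k)" for g :: "'e hedge" and k :: nat
  have im: "fst ` vert h = {fst (\<rho> (\<rho> h)), fst (\<rho> h), fst h}" by (auto simp: vert_def)
  have "(L2_set (tensor (vert h)) (PiE (fst ` vert h) (\<lambda>e. {..\<gamma> e})))\<^sup>2
    = (\<Sum>a\<le>deg h. \<Sum>b\<le>deg (\<rho> h). \<Sum>c\<le>deg (\<rho> (\<rho> h)).
        (tensor (vert h) ((\<lambda>_. undefined)(fst h := a, fst (\<rho> h) := b, fst (\<rho> (\<rho> h)) := c)))\<^sup>2)"
    unfolding im using fst_vert[of h] by (intro L2_set_PiE_triple) auto
  also have "\<dots> = (\<Sum>a\<le>deg h. \<Sum>b\<le>deg (\<rho> h). \<Sum>c\<le>deg (\<rho> (\<rho> h)). G (r h a) (r (\<rho> h) b) (r (\<rho> (\<rho> h)) c))"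
  proof (intro sum.cong refl)
    fix a b c
    define \<kappa> where "\<kappa> = (\<lambda>_. undefined :: nat)(fst h := a, fst (\<rho> h) := b, fst (\<rho> (\<rho> h)) := c)"
    have occ: "occ \<kappa> h = r h a" "occ \<kappa> (\<rho> h) = r (\<rho> h) b" "occ \<kappa> (\<rho> (\<rho> h)) = r (\<rho> (\<rho> h)) c"
      using fst_vert[of h] by (simp_all add: occ_def r_def \<kappa>_def)
    show "(tensor (vert h) \<kappa>)\<^sup>2 = G (r h a) (r (\<rho> h) b) (r (\<rho> (\<rho> h)) c)"
      unfolding tensor_def vsum_vten prod_vert occ G_def deg
      by (simp add: power_mult_distrib xyz mult.assoc)
  qed
  also have "\<dots> = (\<Sum>a\<le>deg h. \<Sum>b\<le>deg (\<rho> h). \<Sum>c\<le>deg (\<rho> (\<rho> h)). G a b c)"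
  proof -
    have reflect: "(\<Sum>k\<le>deg g. F (r g k)) = (\<Sum>k\<le>deg g. F k)" for F :: "nat \<Rightarrow> real" and g
      unfolding r_def by (rule sum_reflect)
    have "(\<Sum>c\<le>deg (\<rho> (\<rho> h)). G a b (r (\<rho> (\<rho> h)) c)) = (\<Sum>c\<le>deg (\<rho> (\<rho> h)). G a b c)" for a b
      by (rule reflect)
    then have "(\<Sum>b\<le>deg (\<rho> h). \<Sum>c\<le>deg (\<rho> (\<rho> h)). G a (r (\<rho> h) b) (r (\<rho> (\<rho> h)) c))
        = (\<Sum>b\<le>deg (\<rho> h). \<Sum>c\<le>deg (\<rho> (\<rho> h)). G a b c)" for a
      using reflect[of "\<lambda>b. \<Sum>c\<le>deg (\<rho> (\<rho> h)). G a b c" "\<rho> h"] by simp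
    then show ?thesis
      using reflect[of "\<lambda>a. \<Sum>b\<le>deg (\<rho> h). \<Sum>c\<le>deg (\<rho> (\<rho> h)). G a b c" h] by simp
  qed
  also have "\<dots> = vnorm x y z" by (simp add: vnorm_def G_def deg)
  finally have "L2_set (tensor (vert h)) (PiE (fst ` vert h) (\<lambda>e. {..\<gamma> e})) = sqrt (vnorm x y z)"
    by (metis L2_set_nonneg real_sqrt_abs abs_of_nonneg)
  then show ?thesis by (simp add: vnorm_eq xyz mult.assoc)
qed

lemma edge_ends:
  "\<exists>v w. v \<noteq> w \<and> v \<in> rvertices \<rho> \<and> w \<in> rvertices \<rho> \<and> {u \<in> rvertices \<rho>. e \<in> fst ` u} = {v, w}"
proof (intro exI conjI)
  show "vert (e, True) \<noteq> vert (e, False)"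
    using no_loops vert_self[of "(e, False)"] unfolding no_loops_def vert_def by blast
  show "vert (e, True) \<in> rvertices \<rho>" "vert (e, False) \<in> rvertices \<rho>" by (simp_all add: rvertices_eq)
  show "{u \<in> rvertices \<rho>. e \<in> fst ` u} = {vert (e, True), vert (e, False)}"
  proof (intro set_eqI iffI)
    fix u assume "u \<in> {u \<in> rvertices \<rho>. e \<in> fst ` u}"
    then obtain b where "u \<in> rvertices \<rho>" "(e, b) \<in> u" by auto
    then have "u = vert (e, b)" by (rule in_rvertices)
    then show "u \<in> {vert (e, True), vert (e, False)}" by (cases b) auto
  next
    fix u assume "u \<in> {vert (e, True), vert (e, False)}"
    then obtain b where u: "u = vert (e, b)" by (metis insertE singletonD)
    have "fst (e, b) \<in> fst ` u" unfolding u by (rule imageI[OF vert_self])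
    then show "u \<in> {u \<in> rvertices \<rho>. e \<in> fst ` u}"
      using u by (simp add: rvertices_eq)
  qed
qed

lemma prod_hedges:
  "(\<Prod>v\<in>rvertices \<rho>. \<Prod>h\<in>v. f h) = (\<Prod>e\<in>UNIV. f (e, True) * f (e, False))" for f :: "'e hedge \<Rightarrow> real"
proof -
  have "\<Union> (rvertices \<rho>) = UNIV" unfolding rvertices_eq using vert_self by blast
  moreover have "(\<Prod>h\<in>\<Union> (rvertices \<rho>). f h) = (\<Prod>v\<in>rvertices \<rho>. \<Prod>h\<in>v. f h)"
  proof -
    have "\<forall>v\<in>rvertices \<rho>. \<forall>w\<in>rvertices \<rho>. v \<noteq> w \<longrightarrow> v \<inter> w = {}"
      using in_rvertices by blast
    then show ?thesis using finite_rvertices(2) by (simp add: prod.Union_disjoint)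
  qed
  moreover have "(\<Prod>h\<in>UNIV. f h) = (\<Prod>e\<in>UNIV. \<Prod>b\<in>UNIV. f (e, b))"
    by (simp add: prod.cartesian_product)
  ultimately show ?thesis by (simp add: UNIV_bool mult.commute)
qed

lemma abs_penrose_eval_le:
  "\<bar>penrose_eval \<rho> \<gamma>\<bar> \<le> (\<Prod>v\<in>rvertices \<rho>. L2_set (tensor v) (PiE (fst ` v) (\<lambda>e. {..\<gamma> e})))"
proof -
  let ?K = "PiE UNIV (\<lambda>e. {..\<gamma> e})"
  let ?T = "\<lambda>\<kappa> v. \<Sum>S\<in>Pow (\<Union>h\<in>v. strands h). vsum \<kappa> v S"
  let ?w = "\<lambda>\<kappa>. \<Prod>e\<in>UNIV. (-1) ^ \<kappa> e * fact (\<kappa> e) * fact (\<gamma> e - \<kappa> e) :: real"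
  obtain c :: real where c: "\<bar>c\<bar> = 1" "penrose_eval \<rho> \<gamma> = c * (\<Sum>\<kappa>\<in>?K. ?w \<kappa> * (\<Prod>v\<in>rvertices \<rho>. ?T \<kappa> v))"
    by (rule penrose_eval_tensor)
  have "\<bar>penrose_eval \<rho> \<gamma>\<bar> \<le> (\<Sum>\<kappa>\<in>?K. \<bar>?w \<kappa> * (\<Prod>v\<in>rvertices \<rho>. ?T \<kappa> v)\<bar>)"
    unfolding c(2) abs_mult c(1) by (simp add: sum_abs abs_mult [symmetric])
  also have "\<dots> = (\<Sum>\<kappa>\<in>?K. \<Prod>v\<in>rvertices \<rho>. tensor v \<kappa>)"
  proof (rule sum.cong[OF refl])
    fix \<kappa> assume \<kappa>: "\<kappa> \<in> ?K"
    have "(\<Prod>v\<in>rvertices \<rho>. \<Prod>h\<in>v. sqrt (fact (occ \<kappa> h) * fact (deg h - occ \<kappa> h))) = \<bar>?w \<kappa>\<bar>"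
      unfolding prod_hedges abs_prod
    proof (rule prod.cong[OF refl])
      fix e
      have "\<kappa> e \<le> \<gamma> e" using \<kappa> by (auto simp: PiE_def)
      then show "sqrt (fact (occ \<kappa> (e, True)) * fact (deg (e, True) - occ \<kappa> (e, True))) *
           sqrt (fact (occ \<kappa> (e, False)) * fact (deg (e, False) - occ \<kappa> (e, False)))
         = \<bar>(-1) ^ \<kappa> e * fact (\<kappa> e) * fact (\<gamma> e - \<kappa> e)\<bar>"
        by (simp add: occ_def abs_mult power_abs real_sqrt_mult mult_ac)
    qed
    then show "\<bar>?w \<kappa> * (\<Prod>v\<in>rvertices \<rho>. ?T \<kappa> v)\<bar> = (\<Prod>v\<in>rvertices \<rho>. tensor v \<kappa>)"
      unfolding tensor_def prod.distrib by (simp add: abs_mult abs_prod mult.commute)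
  qed
  also have "\<dots> \<le> (\<Prod>v\<in>rvertices \<rho>. L2_set (tensor v) (PiE (UNIV \<inter> fst ` v) (\<lambda>e. {..\<gamma> e})))"
  proof (rule tensor_contraction_le)
    show "tensor v \<kappa> \<ge> 0" for v \<kappa>
      unfolding tensor_def by (intro mult_nonneg_nonneg prod_nonneg) auto
    show "tensor v \<kappa> = tensor v \<kappa>'" if "\<forall>e\<in>fst ` v. \<kappa> e = \<kappa>' e" for v \<kappa> \<kappa>'
    proof -
      have "occ \<kappa> h = occ \<kappa>' h" if "h \<in> v" for h
        using \<open>\<forall>e\<in>fst ` v. \<kappa> e = \<kappa>' e\<close> that by (simp add: occ_def)
      then show ?thesis by (simp add: tensor_def vsum_def cong: prod.cong ball_cong)
    qed
  qed (simp_all add: finite_rvertices edge_ends)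
  finally show ?thesis by simp
qed

lemma Theta_vert:
  "Theta (deg h) (deg (\<rho> h)) (deg (\<rho> (\<rho> h))) =
     fact (xn h + xn (\<rho> h) + xn (\<rho> (\<rho> h)) + 1) / (fact (xn h) * fact (xn (\<rho> h)) * fact (xn (\<rho> (\<rho> h))))"
proof -
  define x y z where xyz: "x = xn h" "y = xn (\<rho> h)" "z = xn (\<rho> (\<rho> h))"
  have deg: "deg h = x + z" "deg (\<rho> h) = x + y" "deg (\<rho> (\<rho> h)) = y + z"
    unfolding xyz using deg_eq[of h] deg_\<rho>_eq[of h] by simp_all
  have div: "(x + z + (x + y) + (y + z)) div 2 = x + y + z" "(x + z + (x + y) - (y + z)) div 2 = x"
    "(x + z + (y + z) - (x + y)) div 2 = z" "(x + y + (y + z) - (x + z)) div 2 = y" by auto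
  show ?thesis unfolding deg Theta_def xyz [symmetric] div by (simp only: mult_ac)
qed

text \<open>The description is well defined: rewritten through the strand numbers,
  \<open>Theta\<close> is symmetric, so each half-edge of the vertex yields the same value.\<close>

lemma the_Theta:
  assumes v: "v \<in> rvertices \<rho>"
  shows "(THE t. \<exists>h\<in>v. v = {h, \<rho> h, \<rho> (\<rho> h)} \<and>
          t = Theta (\<gamma> (fst h)) (\<gamma> (fst (\<rho> h))) (\<gamma> (fst (\<rho> (\<rho> h)))))
    = fact ((\<Sum>g\<in>v. xn g) + 1) / (\<Prod>g\<in>v. fact (xn g))"
proof -
  have T: "Theta (\<gamma> (fst h)) (\<gamma> (fst (\<rho> h))) (\<gamma> (fst (\<rho> (\<rho> h)))) = fact ((\<Sum>g\<in>v. xn g) + 1) / (\<Prod>g\<in>v. fact (xn g))"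
    if "h \<in> v" for h
    unfolding Theta_vert in_rvertices[OF v that] sum_vert prod_vert by simp
  obtain h where h: "v = vert h" using v unfolding rvertices_eq by blast
  show ?thesis
  proof (rule the_equality)
    have "h \<in> v" "v = {h, \<rho> h, \<rho> (\<rho> h)}" unfolding h by (rule vert_self, rule vert_def)
    then show "\<exists>h\<in>v. v = {h, \<rho> h, \<rho> (\<rho> h)} \<and>
        fact ((\<Sum>g\<in>v. xn g) + 1) / (\<Prod>g\<in>v. fact (xn g)) = Theta (deg h) (deg (\<rho> h)) (deg (\<rho> (\<rho> h)))"
      using T by metis
  next
    fix t assume "\<exists>h\<in>v. v = {h, \<rho> h, \<rho> (\<rho> h)} \<and> t = Theta (deg h) (deg (\<rho> h)) (deg (\<rho> (\<rho> h)))"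
    then show "t = fact ((\<Sum>g\<in>v. xn g) + 1) / (\<Prod>g\<in>v. fact (xn g))" using T by metis
  qed
qed

text \<open>With \<open>Theta\<close> = G / P at each vertex, the norm sqrt (G P), the factor 1 / P
  of the standard evaluation and sqrt (P / G) multiply to exactly 1.\<close>

lemma abs_unitary_eval_le_1: "\<bar>unitary_eval \<rho> \<gamma>\<bar> \<le> 1"
proof -
  define P :: "'e hedge set \<Rightarrow> real" where "P v = (\<Prod>g\<in>v. fact (xn g))" for v
  define G :: "'e hedge set \<Rightarrow> real" where "G v = fact ((\<Sum>g\<in>v. xn g) + 1)" for v
  have P: "P v > 0" and G: "G v > 0" for v
    unfolding P_def G_def by (intro prod_pos ballI fact_gt_zero) (rule fact_gt_zero)
  have N: "L2_set (tensor v) (PiE (fst ` v) (\<lambda>e. {..\<gamma> e})) = sqrt (G v * P v)" if v: "v \<in> rvertices \<rho>" for v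
  proof -
    obtain h where h: "v = vert h" using v unfolding rvertices_eq by blast
    show ?thesis unfolding h L2_tensor G_def P_def sum_vert prod_vert by (simp add: mult.assoc)
  qed
  have U: "unitary_eval \<rho> \<gamma> = penrose_eval \<rho> \<gamma> / (\<Prod>v\<in>rvertices \<rho>. P v) * (\<Prod>v\<in>rvertices \<rho>. 1 / sqrt (G v / P v))"
    unfolding unitary_eval_def standard_eval_def P_def G_def by (simp add: the_Theta cong: prod.cong)
  have "\<bar>unitary_eval \<rho> \<gamma>\<bar> = \<bar>penrose_eval \<rho> \<gamma>\<bar> * ((\<Prod>v\<in>rvertices \<rho>. 1 / P v) * (\<Prod>v\<in>rvertices \<rho>. 1 / sqrt (G v / P v)))"
    unfolding U using P G by (simp add: abs_mult abs_prod prod_dividef less_imp_le)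
  also have "\<dots> \<le> (\<Prod>v\<in>rvertices \<rho>. sqrt (G v * P v)) * ((\<Prod>v\<in>rvertices \<rho>. 1 / P v) * (\<Prod>v\<in>rvertices \<rho>. 1 / sqrt (G v / P v)))"
    using abs_penrose_eval_le P G
    by (intro mult_right_mono mult_nonneg_nonneg prod_nonneg) (simp_all add: N less_imp_le cong: prod.cong)
  also have "\<dots> = (\<Prod>v\<in>rvertices \<rho>. sqrt (G v * P v) * (1 / P v * (1 / sqrt (G v / P v))))"
    by (simp only: prod.distrib)
  also have "\<dots> = 1"
  proof (rule prod.neutral, rule ballI)
    fix v
    have "sqrt (G v * P v) * (1 / P v * (1 / sqrt (G v / P v))) = sqrt (G v) * sqrt (P v) * sqrt (P v) / (P v * sqrt (G v))"
      by (simp add: real_sqrt_mult real_sqrt_divide)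
    also have "\<dots> = 1" using P[of v] G[of v] by (simp add: mult.assoc)
    finally show "sqrt (G v * P v) * (1 / P v * (1 / sqrt (G v / P v))) = 1" .
  qed
  finally show ?thesis .
qed

end

theorem theorem1:
  fixes \<rho> :: "'e::finite hedge \<Rightarrow> 'e hedge" and \<gamma> :: "'e \<Rightarrow> nat"
  assumes "cubic_ribbon \<rho>" and "no_loops \<rho>" and "admissible \<rho> \<gamma>"
  shows "\<bar>unitary_eval \<rho> \<gamma>\<bar> \<le> 1"
  using assms by (intro spin_network.abs_unitary_eval_le_1 spin_network.intro)

end
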